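(* Let $n\ge 1$ and let $N$ be an $n$-manifold (closed or with boundary). If $M$ is obtained from $N$ by an h-transformation, then $M$ is an $n$-manifold (closed or with boundary).
   Context: A digital space is a simple undirected graph with a finite or countable set of points (vertices). Subspaces are induced subgraphs; $H\subseteq G$ ("$H$ belongs to $G$") means $H$ is an induced subgraph of $G$. The rim $O(v)$ of a point $v$ is the subspace induced on the neighbors of $v$ (not containing $v$). $G-v$ is $G$ with the point $v$ deleted. Contractible graphs and contractible transformations: the one-point graph is contractible; the contractible transformations of a graph are (1) deleting a point $v$ with $O(v)$ contractible, (2) gluing a new point $v$ whose rim $O(v)$ is a contractible induced subgraph, (3) deleting an edge $(uv)$ with $O(u)\cap O(v)$ contractible, (4) adding an edge between non-adjacent points $u,v$ with $O(u)\cap O(v)$ contractible. A graph is contractible if it can be converted to a single point by a finite sequence of contractible transformations. Disks, spheres and manifolds are defined recursively. A 0-disk is a single point; a 0-sphere is the graph $S^0(a,b)$ with two non-adjacent points $a,b$. A 1-sphere is a finite connected graph in which the rim of each point is a 0-sphere. A 1-disk is a graph $S^1-v$ with $S^1$ a 1-sphere, $v\in S^1$. For $n\ge 1$: a closed $n$-manifold is a connected digital space in which the rim of every point is an $(n-1)$-sphere. An $n$-manifold with boundary is a connected space $N$ such that $N=M-v$ (up to isomorphism) for a closed $n$-manifold $M$ and a point $v\in M$; its boundary is $\partial N=O(v)$ and its interior is $\mathrm{Int}N=N-\partial N$. An $n$-disk is an $n$-manifold with boundary that is a contractible graph. For $n\ge 2$, an $n$-sphere is a graph $D\#C$ obtained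 from two $n$-disks $D,C$ with isomorphic boundaries by identifying each point of $\partial D$ with its counterpart in $\partial C$ under an isomorphism. h-transformations of an $n$-manifold $N$: (a) for an $n$-disk $D$ belonging to $N$, replace $N$ by $N+v-\mathrm{Int}D$, obtained by adding a new point $v$ adjacent exactly to all points of $\partial D$ and deleting all points of $\mathrm{Int}D$; (b) for a point $v\in N$ and an $n$-disk $D$ (disjoint from $N$) with $\partial D$ isomorphic to $O(v)$, replace $N$ by $N-v+\mathrm{Int}D$, obtained by identifying each point of $\partial D$ with its counterpart in $O(v)$ under an isomorphism and deleting $v$. *)

theory Defs
  imports "HOL-Library.Countable_Set" "HOL-Library.Infinite_Typeclass"
begin

section \<open>Digital spaces\<close>

record 'a graph =
  points :: "'a set"
  adj :: "('a \<times> 'a) set"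

definition digital_space :: "'a graph \<Rightarrow> bool" where
  "digital_space G \<longleftrightarrow> countable (points G) \<and> adj G \<subseteq> points G \<times> points G \<and> sym (adj G) \<and> irrefl (adj G)"

definition one_point :: "'a \<Rightarrow> 'a graph" where
  "one_point v = \<lparr>points = {v}, adj = {}\<rparr>"

definition induced :: "'a graph \<Rightarrow> 'a set \<Rightarrow> 'a graph" where
  "induced G A = \<lparr>points = points G \<inter> A, adj = adj G \<inter> A \<times> A\<rparr>"

definition belongs_to :: "'a graph \<Rightarrow> 'a graph \<Rightarrow> bool" where
  "belongs_to H G \<longleftrightarrow> points H \<subseteq> points G \<and> H = induced G (points H)"

definition nbrs :: "'a graph \<Rightarrow> 'a \<Rightarrow> 'a set" where
  "nbrs G v = {u. (v, u) \<in> adj G}"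

definition rim :: "'a graph \<Rightarrow> 'a \<Rightarrow> 'a graph" where
  "rim G v = induced G (nbrs G v)"

definition delete_points :: "'a graph \<Rightarrow> 'a set \<Rightarrow> 'a graph" where
  "delete_points G A = induced G (points G - A)"

definition add_point :: "'a graph \<Rightarrow> 'a \<Rightarrow> 'a set \<Rightarrow> 'a graph" where
  "add_point G v A = \<lparr>points = insert v (points G), adj = adj G \<union> {v} \<times> A \<union> A \<times> {v}\<rparr>"

definition add_edge :: "'a graph \<Rightarrow> 'a \<Rightarrow> 'a \<Rightarrow> 'a graph" where
  "add_edge G u v = \<lparr>points = points G, adj = adj G \<union> {(u, v), (v, u)}\<rparr>"

definition delete_edge :: "'a graph \<Rightarrow> 'a \<Rightarrow> 'a \<Rightarrow> 'a graph" where
  "delete_edge G u v = \<lparr>points = points G, adj = adj G - {(u, v), (v, u)}\<rparr>"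

text \<open>The empty graph is not considered connected.\<close>

definition connected_graph :: "'a graph \<Rightarrow> bool" where
  "connected_graph G \<longleftrightarrow> points G \<noteq> {} \<and> (\<forall>x \<in> points G. \<forall>y \<in> points G. (x, y) \<in> (adj G)\<^sup>*)"

definition isomorphism :: "('a \<Rightarrow> 'b) \<Rightarrow> 'a graph \<Rightarrow> 'b graph \<Rightarrow> bool" where
  "isomorphism f G H \<longleftrightarrow> bij_betw f (points G) (points H) \<and> adj H = map_prod f f ` adj G"

text \<open>
  Identification of each point \<open>x\<close> of the set \<open>B\<close> of points of \<open>D\<close> with the point \<open>f x\<close> of \<open>G\<close>.
  The point sets of \<open>G\<close> and \<open>D\<close> are disjoint wherever this is used, and \<open>f\<close> is an isomorphism of
  \<open>induced D B\<close> onto an induced subgraph of \<open>G\<close>; the identified points keep their names in \<open>G\<close>.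
\<close>

definition glue :: "'a graph \<Rightarrow> 'a graph \<Rightarrow> 'a set \<Rightarrow> ('a \<Rightarrow> 'a) \<Rightarrow> 'a graph" where
  "glue G D B f = (let g = (\<lambda>x. if x \<in> B then f x else x) in
     \<lparr>points = points G \<union> g ` points D, adj = adj G \<union> map_prod g g ` adj D\<rparr>)"


section \<open>Contractible graphs\<close>

text \<open>
  Points are drawn from an infinite type, so that a new point can always be glued to a finite graph
  (a graph that can be converted to a point is finite) and every digital space has an isomorphic
  copy in the same type with room for further points.
\<close>

inductive contractible :: "'a::infinite graph \<Rightarrow> bool"
  and contractible_transformation :: "'a graph \<Rightarrow> 'a graph \<Rightarrow> bool" where
  one_point: "contractible (one_point v)"
| step: "contractible_transformation G H \<Longrightarrow> contractible H \<Longrightarrow> contractible G"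
| delete_point:
    "digital_space G \<Longrightarrow> v \<in> points G \<Longrightarrow> contractible (rim G v) \<Longrightarrow>
     contractible_transformation G (delete_points G {v})"
| glue_point:
    "digital_space G \<Longrightarrow> v \<notin> points G \<Longrightarrow> A \<subseteq> points G \<Longrightarrow> contractible (induced G A) \<Longrightarrow>
     contractible_transformation G (add_point G v A)"
| delete_edge:
    "digital_space G \<Longrightarrow> (u, v) \<in> adj G \<Longrightarrow> contractible (induced G (nbrs G u \<inter> nbrs G v)) \<Longrightarrow>
     contractible_transformation G (delete_edge G u v)"
| add_edge:
    "digital_space G \<Longrightarrow> u \<in> points G \<Longrightarrow> v \<in> points G \<Longrightarrow> u \<noteq> v \<Longrightarrow> (u, v) \<notin> adj G \<Longrightarrow>
     contractible (induced G (nbrs G u \<inter> nbrs G v)) \<Longrightarrow>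
     contractible_transformation G (add_edge G u v)"


section \<open>Spheres, manifolds and disks\<close>

text \<open>
  \<open>manifold_with_boundary n N B\<close> and \<open>disk n N B\<close> state that \<open>N\<close> is an \<open>n\<close>-manifold with boundary
  (respectively an \<open>n\<close>-disk) whose boundary \<open>\<partial>N\<close> is the subspace induced on the point set \<open>B\<close>;
  the interior is the subspace induced on \<open>points N - B\<close>. Closed manifolds, manifolds with boundary
  and disks are defined for \<open>n \<ge> 1\<close> only. The dimension \<open>n - 1\<close> of a rim is expressed by using
  \<open>Suc n\<close> for the dimension of the manifold.
\<close>

inductive sphere :: "nat \<Rightarrow> 'a::infinite graph \<Rightarrow> bool"
  and closed_manifold :: "nat \<Rightarrow> 'a graph \<Rightarrow> bool"
  and manifold_with_boundary :: "nat \<Rightarrow> 'a graph \<Rightarrow> 'a set \<Rightarrow> bool"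
  and disk :: "nat \<Rightarrow> 'a graph \<Rightarrow> 'a set \<Rightarrow> bool" where
  sphere_0: "a \<noteq> b \<Longrightarrow> sphere 0 \<lparr>points = {a, b}, adj = {}\<rparr>"
| sphere_1:
    "digital_space G \<Longrightarrow> finite (points G) \<Longrightarrow> connected_graph G \<Longrightarrow>
     \<forall>v \<in> points G. sphere 0 (rim G v) \<Longrightarrow> sphere 1 G"
| sphere_n:
    "n \<ge> 2 \<Longrightarrow> disk n D BD \<Longrightarrow> disk n C BC \<Longrightarrow> points D \<inter> points C = {} \<Longrightarrow>
     isomorphism f (induced C BC) (induced D BD) \<Longrightarrow> isomorphism h (glue D C BC f) G \<Longrightarrow> sphere n G"
| closed_manifold:
    "digital_space M \<Longrightarrow> connected_graph M \<Longrightarrow>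
     \<forall>v \<in> points M. sphere n (rim M v) \<Longrightarrow> closed_manifold (Suc n) M"
| manifold_with_boundary:
    "closed_manifold n M \<Longrightarrow> v \<in> points M \<Longrightarrow> isomorphism f (delete_points M {v}) N \<Longrightarrow>
     connected_graph N \<Longrightarrow> manifold_with_boundary n N (f ` nbrs M v)"
| disk: "manifold_with_boundary n D B \<Longrightarrow> contractible D \<Longrightarrow> disk n D B"

definition manifold :: "nat \<Rightarrow> 'a::infinite graph \<Rightarrow> bool" where
  "manifold n N \<longleftrightarrow> closed_manifold n N \<or> (\<exists>B. manifold_with_boundary n N B)"


section \<open>h-transformations\<close>

text \<open>
  The two rules construct the result on the points of \<open>N\<close>, the new point \<open>v\<close> and the points of \<open>D\<close>,
  all taken from one type; the type being arbitrary, it can be chosen large enough to provide them.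
\<close>

inductive h_transformation :: "nat \<Rightarrow> 'a::infinite graph \<Rightarrow> 'a graph \<Rightarrow> bool" for n N where
  replace_disk:
    "disk n D B \<Longrightarrow> belongs_to D N \<Longrightarrow> v \<notin> points N \<Longrightarrow>
     h_transformation n N (delete_points (add_point N v B) (points D - B))"
| replace_point:
    "v \<in> points N \<Longrightarrow> disk n D B \<Longrightarrow> points D \<inter> points N = {} \<Longrightarrow>
     isomorphism f (induced D B) (rim N v) \<Longrightarrow>
     h_transformation n N (delete_points (glue N D B f) {v})"

end

theory Submission
  imports Defs
begin

text \<open>
  A closed \<open>n\<close>-manifold is a sphere iff the complement of one of its points is contractible,
  and then the complement of every point is: for adjacent \<open>u\<close>, \<open>v\<close>
  the rim of \<open>v\<close> in \<open>G - u\<close> is a lower-dimensional sphere minus a point, hence contractible, so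
  \<open>G - u\<close> and \<open>G - v\<close> are both equivalent to \<open>G - u - v\<close>.

  Both h-transformations exchange a point \<open>v\<close> and the interior \<open>A\<close> of a disk inside one graph \<open>W\<close>:
  they pass between \<open>W - v\<close> and \<open>W - A\<close>. At a point \<open>x\<close> adjacent to \<open>v\<close> the rims are related by
  an exchange of one dimension less, so the claim reduces to spheres. For those, deleting a point
  \<open>p\<close> away from the disk and from \<open>v\<close> from both sides gives graphs of the same homotopy type, since
  the disk and the cone over its boundary are both contractible.
\<close>

section \<open>Graphs and isomorphic copies\<close>

text \<open>Replacing a disk \<open>D\<close> only assumes that \<open>D\<close> is an induced
  subgraph of \<open>N\<close>. The definition does not say that interior points of \<open>D\<close>
  have all their neighbours in \<open>D\<close>, nor that they avoid the boundary of
  \<open>N\<close>. Both follow from rigidity: a sphere has no proper induced subgraph that is a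
  sphere of the same dimension. The rim in \<open>D\<close> of an interior point is such a sphere
  inside its rim in \<open>N\<close>, so the two agree.

  A boundary is handled by closing it off: \<open>N\<close> with boundary \<open>B\<close> is viewed
  as a connected graph that becomes a closed manifold once an extra point adjacent exactly to
  \<open>B\<close> is added. The exchange then takes place in the closed-off graph, away from the
  extra point.

  The gluing of two disks in the definition of spheres is an exchange as well: the glued graph
  arises from the closed-off first disk when its extra point is traded for the interior of the
  second. For this reason exchanges are studied on the recursive description of spheres, before that
  description is shown to agree with the given one.\<close>

lemma graph_eqI: "points G = points H \<Longrightarrow> adj G = adj H \<Longrightarrow> G = (H :: 'a graph)"
  by simp

lemma points_induced [simp]: "points (induced G A) = points G \<inter> A"
  and adj_induced [simp]: "adj (induced G A) = adj G \<inter> A \<times> A"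
  and induced_induced [simp]: "induced (induced G A) B = induced G (A \<inter> B)"
  by (auto simp: induced_def)

lemma delete_points_simps [simp]:
  "points (delete_points G A) = points G - A"
  "adj (delete_points G A) = adj G \<inter> (points G - A) \<times> (points G - A)"
  by (auto simp: delete_points_def)

lemma add_point_simps [simp]:
  "points (add_point G v A) = insert v (points G)"
  "adj (add_point G v A) = adj G \<union> {v} \<times> A \<union> A \<times> {v}"
  by (auto simp: add_point_def)

lemma one_point_simps [simp]: "points (one_point v) = {v}" "adj (one_point v) = {}"
  by (auto simp: one_point_def)

lemma points_rim [simp]: "points (rim G v) = points G \<inter> nbrs G v"
  by (simp add: rim_def)

lemma nbrs_iff [simp]: "u \<in> nbrs G v \<longleftrightarrow> (v, u) \<in> adj G"
  by (simp add: nbrs_def)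

lemma digital_adjD:
  assumes "digital_space G" "(u, v) \<in> adj G"
  shows "(v, u) \<in> adj G" "u \<in> points G" "v \<in> points G" "u \<noteq> v"
  using assms by (auto simp: digital_space_def sym_def irrefl_def)

lemma nbrs_subset: "digital_space G \<Longrightarrow> nbrs G v \<subseteq> points G"
  by (auto dest: digital_adjD(2-4))

lemma not_adj_self [simp]: "digital_space G \<Longrightarrow> (v, v) \<notin> adj G"
  by (auto dest: digital_adjD(2-4))

lemma digital_induced [simp]: "digital_space G \<Longrightarrow> digital_space (induced G A)"
  by (auto simp: digital_space_def sym_def irrefl_def)

lemma digital_delete_points [simp]: "digital_space G \<Longrightarrow> digital_space (delete_points G A)"
  by (simp add: delete_points_def)

lemma digital_rim [simp]: "digital_space G \<Longrightarrow> digital_space (rim G v)"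
  by (simp add: rim_def)

lemma digital_add_point:
  "digital_space G \<Longrightarrow> v \<notin> points G \<Longrightarrow> A \<subseteq> points G \<Longrightarrow> digital_space (add_point G v A)"
  by (auto simp: digital_space_def sym_def irrefl_def)

lemma digital_one_point [simp]: "digital_space (one_point v)"
  by (auto simp: digital_space_def sym_def irrefl_def)

lemma induced_superset [simp]:
  "digital_space G \<Longrightarrow> points G \<subseteq> A \<Longrightarrow> induced G A = G"
  by (rule graph_eqI) (auto dest: digital_adjD(2-4))

lemma rim_induced:
  "v \<in> A \<Longrightarrow> rim (induced G A) v = induced G (A \<inter> nbrs G v)"
  by (rule graph_eqI) (auto simp: rim_def)

lemma rim_delete_points:
  assumes "digital_space G" "v \<in> points G" "v \<notin> A"
  shows "rim (delete_points G A) v = delete_points (rim G v) A"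
  using assms by (intro graph_eqI) (auto simp: rim_def dest: digital_adjD(2-4))

lemma nbrs_rim: "(v, x) \<in> adj G \<Longrightarrow> nbrs (rim G v) x = nbrs G v \<inter> nbrs G x"
  by (auto simp: rim_def)

text \<open>The points reachable from \<open>x\<close> form a nonempty set closed under adjacency.
  This turns every later connectedness argument into one about closed sets, without paths.\<close>

lemma connected_graph_iff:
  assumes "digital_space G"
  shows "connected_graph G \<longleftrightarrow> points G \<noteq> {} \<and>
    (\<forall>S \<subseteq> points G. S \<noteq> {} \<longrightarrow> (\<forall>x \<in> S. nbrs G x \<subseteq> S) \<longrightarrow> S = points G)"
    (is "_ \<longleftrightarrow> _ \<and> ?R")
proof (intro iffI conjI)
  assume c: "connected_graph G"
  then show "points G \<noteq> {}" by (simp add: connected_graph_def)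
  show ?R
  proof (intro allI impI)
    fix S assume S: "S \<subseteq> points G" "S \<noteq> {}" "\<forall>x \<in> S. nbrs G x \<subseteq> S"
    then obtain x where x: "x \<in> S" by blast
    have "y \<in> S" if "(x, y) \<in> (adj G)\<^sup>*" for y
      using that x S(3) by (induction rule: rtrancl_induct) (auto simp: subset_iff)
    moreover have "(x, y) \<in> (adj G)\<^sup>*" if "y \<in> points G" for y
      using c that x S(1) by (auto simp: connected_graph_def)
    ultimately show "S = points G" using S(1) by blast
  qed
next
  assume r: "points G \<noteq> {} \<and> ?R"
  have "(x, y) \<in> (adj G)\<^sup>*" if "x \<in> points G" "y \<in> points G" for x y
  proof -
    define S where "S = {z \<in> points G. (x, z) \<in> (adj G)\<^sup>*}"
    have "\<forall>z \<in> S. nbrs G z \<subseteq> S"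
      using digital_adjD(3)[OF assms] by (auto simp: S_def intro: rtrancl_into_rtrancl)
    moreover have "S \<subseteq> points G" "S \<noteq> {}" using that(1) by (auto simp: S_def)
    ultimately have "S = points G" using r by blast
    then show ?thesis using that(2) by (auto simp: S_def)
  qed
  then show "connected_graph G" using r by (simp add: connected_graph_def)
qed

lemma connected_graph_nonempty: "connected_graph G \<Longrightarrow> points G \<noteq> {}"
  by (simp add: connected_graph_def)

lemma connected_graphD:
  assumes "connected_graph G" "digital_space G" "S \<subseteq> points G" "S \<noteq> {}"
    "\<And>x y. x \<in> S \<Longrightarrow> (x, y) \<in> adj G \<Longrightarrow> y \<in> S"
  shows "S = points G"
proof -
  have "\<forall>x \<in> S. nbrs G x \<subseteq> S" using assms(5) by auto
  then show ?thesis using assms(1,3,4) unfolding connected_graph_iff[OF assms(2)] by blast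
qed

lemma connected_graphI:
  assumes "digital_space G" "points G \<noteq> {}"
    "\<And>S. S \<subseteq> points G \<Longrightarrow> S \<noteq> {} \<Longrightarrow> (\<And>x y. x \<in> S \<Longrightarrow> (x, y) \<in> adj G \<Longrightarrow> y \<in> S) \<Longrightarrow> points G \<subseteq> S"
  shows "connected_graph G"
  unfolding connected_graph_iff[OF assms(1)]
proof (intro conjI allI impI)
  fix S assume S: "S \<subseteq> points G" "S \<noteq> {}" "\<forall>x \<in> S. nbrs G x \<subseteq> S"
  then have "y \<in> S" if "x \<in> S" "(x, y) \<in> adj G" for x y using that by (auto simp: subset_iff)
  with S(1,2) show "S = points G" using assms(3) by blast
qed (rule assms(2))

section \<open>Isomorphic copies, written as a renaming of the points\<close>

definition map_graph :: "('a \<Rightarrow> 'b) \<Rightarrow> 'a graph \<Rightarrow> 'b graph" where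
  "map_graph e G = \<lparr>points = e ` points G, adj = map_prod e e ` adj G\<rparr>"

lemma map_graph_simps [simp]:
  "points (map_graph e G) = e ` points G"
  "adj (map_graph e G) = map_prod e e ` adj G"
  by (simp_all add: map_graph_def)

lemma isomorphism_iff: "isomorphism f G H \<longleftrightarrow> inj_on f (points G) \<and> H = map_graph f G"
  by (auto simp: isomorphism_def bij_betw_def intro: graph_eqI)

lemma map_graph_cong:
  "digital_space G \<Longrightarrow> (\<And>x. x \<in> points G \<Longrightarrow> e x = e' x) \<Longrightarrow> map_graph e G = map_graph e' G"
  unfolding map_graph_def
  by (intro arg_cong2[where f = "\<lambda>p a. \<lparr>points = p, adj = a\<rparr>"] image_cong)
    (auto simp: digital_space_def)

lemma map_graph_id: "digital_space G \<Longrightarrow> (\<And>x. x \<in> points G \<Longrightarrow> e x = x) \<Longrightarrow> map_graph e G = G"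
proof -
  assume "digital_space G" "\<And>x. x \<in> points G \<Longrightarrow> e x = x"
  then have "map_graph e G = map_graph id G" by (intro map_graph_cong) auto
  then show ?thesis by (simp add: map_graph_def prod.map_id0)
qed

lemma map_graph_comp: "map_graph e (map_graph e' G) = map_graph (e \<circ> e') G"
  by (auto simp: map_graph_def image_comp prod.map_comp)

context
  fixes e :: "'a \<Rightarrow> 'b" and G
  assumes ds: "digital_space G" and inj: "inj_on e (points G)"
begin

lemma adj_map_graph_iff:
  assumes "x \<in> points G" "y \<in> points G"
  shows "(e x, e y) \<in> map_prod e e ` adj G \<longleftrightarrow> (x, y) \<in> adj G"
proof
  assume "(e x, e y) \<in> map_prod e e ` adj G"
  then obtain x' y' where "(x', y') \<in> adj G" "e x = e x'" "e y = e y'" by auto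
  then show "(x, y) \<in> adj G"
    using inj assms digital_adjD[OF ds] by (metis inj_onD)
qed force

lemma digital_map_graph: "digital_space (map_graph e G)"
  unfolding digital_space_def
proof (intro conjI)
  show "irrefl (adj (map_graph e G))"
  proof (rule irreflI)
    fix a show "(a, a) \<notin> adj (map_graph e G)"
      using inj by (auto dest: digital_adjD(2-4)[OF ds] inj_onD)
  qed
  show "sym (adj (map_graph e G))"
  proof (rule symI)
    fix a b assume "(a, b) \<in> adj (map_graph e G)"
    then obtain x y where "(x, y) \<in> adj G" "a = e x" "b = e y" by auto
    then show "(b, a) \<in> adj (map_graph e G)"
      using digital_adjD(1)[OF ds, of x y] by force
  qed
  show "adj (map_graph e G) \<subseteq> points (map_graph e G) \<times> points (map_graph e G)"
    by (auto dest: digital_adjD(2-4)[OF ds])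
  show "countable (points (map_graph e G))"
    using ds by (auto simp: digital_space_def)
qed

lemma map_graph_induced:
  assumes "S \<subseteq> points G"
  shows "map_graph e (induced G S) = induced (map_graph e G) (e ` S)"
proof (rule graph_eqI)
  show "adj (map_graph e (induced G S)) = adj (induced (map_graph e G) (e ` S))"
  proof (intro equalityI subsetI)
    fix p assume p: "p \<in> adj (induced (map_graph e G) (e ` S))"
    then have *: "p \<in> e ` S \<times> e ` S" "p \<in> map_prod e e ` adj G" by simp_all
    from *(1) obtain x y where "x \<in> S" "y \<in> S" "p = (e x, e y)" by (elim SigmaE imageE) simp
    moreover from this have "(x, y) \<in> adj G"
      using assms adj_map_graph_iff[of x y] *(2) by auto
    ultimately show "p \<in> adj (map_graph e (induced G S))" by force
  qed auto
qed (use assms in auto)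

lemma nbrs_map_graph:
  assumes "v \<in> points G"
  shows "nbrs (map_graph e G) (e v) = e ` nbrs G v"
proof (intro equalityI subsetI)
  fix y assume "y \<in> nbrs (map_graph e G) (e v)"
  then obtain x u where "(x, u) \<in> adj G" "e x = e v" "y = e u" by auto
  moreover from this have "x = v" using inj assms digital_adjD[OF ds] by (metis inj_onD)
  ultimately show "y \<in> e ` nbrs G v" by auto
qed force

lemma rim_map_graph:
  assumes "v \<in> points G"
  shows "rim (map_graph e G) (e v) = map_graph e (rim G v)"
  using assms nbrs_subset[OF ds]
  by (simp add: rim_def nbrs_map_graph map_graph_induced)

lemma delete_points_map_graph:
  assumes "A \<subseteq> points G"
  shows "delete_points (map_graph e G) (e ` A) = map_graph e (delete_points G A)"
proof -
  have "e ` points G - e ` A = e ` (points G - A)"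
    using inj assms by (simp add: inj_on_image_set_diff)
  then show ?thesis by (simp add: delete_points_def map_graph_induced)
qed

lemma connected_map_graph: "connected_graph G \<Longrightarrow> connected_graph (map_graph e G)"
proof (rule connected_graphI[OF digital_map_graph])
  fix S assume c: "connected_graph G" and S: "S \<subseteq> points (map_graph e G)" "S \<noteq> {}"
    "\<And>x y. x \<in> S \<Longrightarrow> (x, y) \<in> adj (map_graph e G) \<Longrightarrow> y \<in> S"
  let ?T = "{x \<in> points G. e x \<in> S}"
  have "?T = points G"
  proof (rule connected_graphD[OF c ds])
    fix x y assume "x \<in> ?T" "(x, y) \<in> adj G"
    then show "y \<in> ?T" using S(3)[of "e x" "e y"] by (auto dest: digital_adjD(2-4)[OF ds])
  qed (use S in auto)
  then show "points (map_graph e G) \<subseteq> S" by auto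
qed (auto dest: connected_graph_nonempty)

lemma map_graph_inv: "map_graph (inv_into (points G) e) (map_graph e G) = G"
  unfolding map_graph_comp using inj by (intro map_graph_id[OF ds]) simp

end

section \<open>Contractible graphs\<close>

lemma contractible_finite_digital:
  "contractible G \<Longrightarrow> finite (points G) \<and> digital_space G"
  "contractible_transformation G H \<Longrightarrow> digital_space G \<and> (finite (points H) \<longrightarrow> finite (points G))"
  by (induction rule: contractible_contractible_transformation.inducts)
    (auto simp: delete_edge_def add_edge_def)

lemmas contractible_finite = contractible_finite_digital(1)[THEN conjunct1]

text \<open>Contractibility is inherited backwards along a transformation, so each case recovers
  connectedness of \<open>G\<close> from that of \<open>H\<close>. The subgraph that the
  transformation requires to be contractible is connected and nonempty by induction: it attaches the
  deleted point, replaces detours through the glued point, or supplies a common neighbour that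
  bypasses the added edge.\<close>

lemma contractible_transformation_connected:
  "contractible G \<Longrightarrow> connected_graph G"
  "contractible_transformation G H \<Longrightarrow> connected_graph H \<longrightarrow> connected_graph G"
proof (induction rule: contractible_contractible_transformation.inducts)
  case (delete_point G v)
  show ?case
  proof (intro impI connected_graphI[OF delete_point(1)])
    assume c: "connected_graph (delete_points G {v})"
    obtain u where u: "(v, u) \<in> adj G"
      using connected_graph_nonempty[OF delete_point.IH] by auto
    fix S assume S: "S \<subseteq> points G" "S \<noteq> {}" "\<And>x y. x \<in> S \<Longrightarrow> (x, y) \<in> adj G \<Longrightarrow> y \<in> S"
    have "S - {v} \<noteq> {}" using S u digital_adjD[OF delete_point(1)] by blast
    then have "S - {v} = points (delete_points G {v})"
      using S delete_point(1) by (intro connected_graphD[OF c]) auto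
    moreover from this have "v \<in> S" using S(3)[of u v] u digital_adjD[OF delete_point(1) u] by auto
    ultimately show "points G \<subseteq> S" by auto
  qed (use delete_point in auto)
next
  case (glue_point G v A)
  show ?case
  proof (intro impI connected_graphI[OF glue_point(1)])
    let ?H = "add_point G v A"
    assume c: "connected_graph ?H"
    have dH: "digital_space ?H" using glue_point by (intro digital_add_point)
    fix S assume S: "S \<subseteq> points G" "S \<noteq> {}" "\<And>x y. x \<in> S \<Longrightarrow> (x, y) \<in> adj G \<Longrightarrow> y \<in> S"
    show "points G \<subseteq> S"
    proof (cases "S \<inter> A = {}")
      case True
      have "S = points ?H"
        using S True glue_point by (intro connected_graphD[OF c dH]) auto
      then show ?thesis by auto
    next
      case False
      have "S \<inter> A = points (induced G A)"
        using S False glue_point by (intro connected_graphD[OF glue_point.IH]) auto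
      then have "A \<subseteq> S" using glue_point by auto
      then have "insert v S = points ?H"
        using S glue_point digital_adjD[OF glue_point(1)]
        by (intro connected_graphD[OF c dH]) auto
      then show ?thesis using glue_point by auto
    qed
  qed (use connected_graph_nonempty[OF glue_point.IH] in auto)
next
  case (delete_edge G u v)
  have d: "digital_space (delete_edge G u v)"
    using delete_edge(1) by (auto simp: delete_edge_def digital_space_def sym_def irrefl_def)
  show ?case
  proof (intro impI connected_graphI[OF delete_edge(1)])
    assume c: "connected_graph (delete_edge G u v)"
    fix S assume S: "S \<subseteq> points G" "S \<noteq> {}" "\<And>x y. x \<in> S \<Longrightarrow> (x, y) \<in> adj G \<Longrightarrow> y \<in> S"
    have "S = points (delete_edge G u v)"
      by (rule connected_graphD[OF c d]) (use S in \<open>auto simp: delete_edge_def\<close>)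
    then show "points G \<subseteq> S" by (simp add: delete_edge_def)
  qed (use delete_edge(2) digital_adjD[OF delete_edge(1)] in blast)
next
  case (add_edge G u v)
  obtain w where w: "(u, w) \<in> adj G" "(v, w) \<in> adj G"
    using connected_graph_nonempty[OF add_edge.IH] by auto
  note w' = digital_adjD(1)[OF add_edge(1) w(1)] digital_adjD(1)[OF add_edge(1) w(2)]
  have d: "digital_space (add_edge G u v)"
    using add_edge(1-4) by (auto simp: add_edge_def digital_space_def sym_def irrefl_def)
  show ?case
  proof (intro impI connected_graphI[OF add_edge(1)])
    assume c: "connected_graph (add_edge G u v)"
    fix S assume S: "S \<subseteq> points G" "S \<noteq> {}" "\<And>x y. x \<in> S \<Longrightarrow> (x, y) \<in> adj G \<Longrightarrow> y \<in> S"
    have "S = points (add_edge G u v)"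
    proof (rule connected_graphD[OF c d])
      fix x y assume "x \<in> S" "(x, y) \<in> adj (add_edge G u v)"
      then consider "(x, y) \<in> adj G" | "x = u" "y = v" | "x = v" "y = u"
        by (auto simp: add_edge_def)
      then show "y \<in> S"
        by cases (use S(3) w w' \<open>x \<in> S\<close> in blast)+
    qed (use S in \<open>auto simp: add_edge_def\<close>)
    then show "points G \<subseteq> S" by (simp add: add_edge_def)
  qed (use add_edge(2) in blast)
qed (simp_all add: connected_graph_def)

text \<open>Gluing \<open>v\<close> back onto its rim undoes the deletion, so the one-sided rule
  \<open>step\<close> can be used in either direction.\<close>

lemma contractible_delete_point_iff:
  assumes "digital_space G" "v \<in> points G" "contractible (rim G v)"
  shows "contractible (delete_points G {v}) \<longleftrightarrow> contractible G"
proof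
  assume "contractible (delete_points G {v})"
  then show "contractible G"
    using delete_point[OF assms] step by blast
next
  let ?H = "delete_points G {v}"
  assume G: "contractible G"
  have n: "nbrs G v \<subseteq> points ?H" using assms digital_adjD[OF assms(1)] by auto
  have "induced ?H (nbrs G v) = rim G v"
    using n by (intro graph_eqI) (auto simp: rim_def)
  then have "contractible_transformation ?H (add_point ?H v (nbrs G v))"
    using assms n by (intro glue_point) auto
  moreover have "add_point ?H v (nbrs G v) = G"
  proof (rule graph_eqI)
    show "adj (add_point ?H v (nbrs G v)) = adj G"
      using digital_adjD[OF assms(1)] by auto
  qed (use assms in auto)
  ultimately show "contractible ?H" using G step by metis
qed

text \<open>A point other than the apex can be deleted: its rim and its complement are smaller cones
  with the same apex.\<close>

lemma contractible_cone:
  assumes "finite (points G)" "digital_space G" "v \<in> points G"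
    "\<And>x. x \<in> points G \<Longrightarrow> x \<noteq> v \<Longrightarrow> (v, x) \<in> adj G"
  shows "contractible G"
  using assms
proof (induction "card (points G)" arbitrary: G rule: less_induct)
  case less
  show ?case
  proof (cases "points G = {v}")
    case True
    then have "G = one_point v"
      using digital_adjD[OF less.prems(2)] by (intro graph_eqI) auto
    then show ?thesis by (simp add: contractible_contractible_transformation.one_point)
  next
    case False
    then obtain x where x: "x \<in> points G" "x \<noteq> v" using less.prems(3) by blast
    then have vx: "(v, x) \<in> adj G" "(x, v) \<in> adj G"
      using less.prems(4) digital_adjD(1)[OF less.prems(2)] by blast+
    have "contractible (rim G x)"
    proof (rule less.hyps)
      show "card (points (rim G x)) < card (points G)"
        using x less.prems(1) not_adj_self[OF less.prems(2), of x]
        by (intro psubset_card_mono psubsetI) auto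
    qed (use less.prems vx in \<open>auto simp: rim_def\<close>)
    moreover have "contractible (delete_points G {x})"
    proof (rule less.hyps)
      show "card (points (delete_points G {x})) < card (points G)"
        using x less.prems(1,2) by (intro psubset_card_mono) auto
    qed (use less.prems x in auto)
    ultimately show ?thesis using contractible_delete_point_iff less.prems(2) x(1) by blast
  qed
qed

section \<open>Contractibility under renaming\<close>

lemma map_graph_add_point:
  assumes "digital_space G" "v \<notin> points G" "A \<subseteq> points G"
  shows "map_graph (e(v := w)) (add_point G v A) = add_point (map_graph e G) w (e ` A)"
proof (rule graph_eqI)
  have a: "map_prod (e(v := w)) (e(v := w)) ` adj G = map_prod e e ` adj G"
    using assms digital_adjD(2,3)[OF assms(1)] by (intro image_cong) auto
  have b: "e(v := w) ` A = e ` A" using assms by (intro image_cong) auto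
  show "adj (map_graph (e(v := w)) (add_point G v A)) = adj (add_point (map_graph e G) w (e ` A))"
    by (simp only: map_graph_simps add_point_simps image_Un a map_prod_surj_on[OF refl refl] b
        image_insert image_empty fun_upd_same)
qed (use assms in auto)

text \<open>The map \<open>e\<close> is quantified inside the induction because a glued point needs
  an image of its own. The premise \<open>contractible H\<close> in the second part provides the
  finiteness that makes such an image available.\<close>

lemma contractible_map_graph_aux:
  "contractible G \<Longrightarrow> \<forall>e :: 'a::infinite \<Rightarrow> 'b::infinite. inj_on e (points G) \<longrightarrow> contractible (map_graph e G)"
  "contractible_transformation G H \<Longrightarrow> contractible H \<longrightarrow>
    (\<forall>e :: 'a \<Rightarrow> 'b. inj_on e (points H) \<longrightarrow> contractible (map_graph e H)) \<longrightarrow>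
    (\<forall>e :: 'a \<Rightarrow> 'b. inj_on e (points G) \<longrightarrow> contractible (map_graph e G))"
proof (induction rule: contractible_contractible_transformation.inducts)
  case (one_point v)
  have "map_graph e (one_point v) = one_point (e v)" for e :: "'a \<Rightarrow> 'b"
    by (rule graph_eqI) auto
  then show ?case using contractible_contractible_transformation.one_point by metis
next
  case (step G H)
  then show ?case by blast
next
  case (delete_point G v)
  show ?case
  proof (intro impI allI)
    fix e :: "'a \<Rightarrow> 'b" assume e: "inj_on e (points G)"
      and IH: "\<forall>e :: 'a \<Rightarrow> 'b. inj_on e (points (delete_points G {v})) \<longrightarrow> contractible (map_graph e (delete_points G {v}))"
    have "delete_points (map_graph e G) {e v} = map_graph e (delete_points G {v})"
      using delete_points_map_graph[OF delete_point(1) e, of "{v}"] delete_point(2) by simp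
    moreover have "contractible (map_graph e (delete_points G {v}))"
      using IH e by (auto intro: inj_on_subset)
    moreover have "contractible (rim (map_graph e G) (e v))"
      using delete_point e by (auto simp: rim_map_graph intro: inj_on_subset)
    ultimately show "contractible (map_graph e G)"
      using contractible_delete_point_iff[of "map_graph e G" "e v"] delete_point(1,2)
        digital_map_graph[OF delete_point(1) e] by auto
  qed
next
  case (glue_point G v A)
  show ?case
  proof (intro impI allI)
    fix e :: "'a \<Rightarrow> 'b" assume e: "inj_on e (points G)" and "contractible (add_point G v A)"
      and IH: "\<forall>e :: 'a \<Rightarrow> 'b. inj_on e (points (add_point G v A)) \<longrightarrow> contractible (map_graph e (add_point G v A))"
    then have "finite (points G)" using contractible_finite by force
    \<comment> \<open>The value of \<open>e\<close> at the new point \<open>v\<close> may collide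
      with an image of a point of \<open>G\<close>; a fresh value exists because \<open>'b\<close>
      is infinite.\<close>
    then obtain w where w: "w \<notin> e ` points G" using arb_element[of "e ` points G"] by auto
    have "inj_on (e(v := w)) (points (add_point G v A))"
      using e w glue_point(2) by (auto simp: inj_on_def)
    then have "contractible (add_point (map_graph e G) w (e ` A))"
      using IH map_graph_add_point[OF glue_point(1-3), of e w] by metis
    moreover have "contractible_transformation (map_graph e G) (add_point (map_graph e G) w (e ` A))"
    proof (rule contractible_contractible_transformation.glue_point)
      have "inj_on e (points (induced G A))" using e by (auto intro: inj_on_subset)
      then show "contractible (induced (map_graph e G) (e ` A))"
        using glue_point by (metis map_graph_induced e)
    qed (use w glue_point digital_map_graph[OF glue_point(1) e] in auto)
    ultimately show "contractible (map_graph e G)" using step by blast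
  qed
next
  case (delete_edge G u v)
  show ?case
  proof (intro impI allI)
    fix e :: "'a \<Rightarrow> 'b" assume e: "inj_on e (points G)"
      and IH: "\<forall>e :: 'a \<Rightarrow> 'b. inj_on e (points (delete_edge G u v)) \<longrightarrow> contractible (map_graph e (delete_edge G u v))"
    note uv = digital_adjD[OF delete_edge(1,2)]
    have "inj_on (map_prod e e) (points G \<times> points G)" using e by (simp add: map_prod_inj_on)
    then have "map_prod e e ` (adj G - {(u, v), (v, u)}) = map_prod e e ` adj G - map_prod e e ` {(u, v), (v, u)}"
      by (rule inj_on_image_set_diff) (use uv digital_adjD(2,3)[OF delete_edge(1)] in auto)
    then have "map_graph e (delete_edge G u v) = delete_edge (map_graph e G) (e u) (e v)"
      by (intro graph_eqI) (auto simp: delete_edge_def)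
    moreover have "contractible (map_graph e (delete_edge G u v))"
      using IH e by (auto simp: delete_edge_def)
    moreover have "contractible_transformation (map_graph e G) (delete_edge (map_graph e G) (e u) (e v))"
    proof (rule contractible_contractible_transformation.delete_edge)
      have n: "nbrs G u \<inter> nbrs G v \<subseteq> points G" using nbrs_subset[OF delete_edge(1)] by blast
      have "e ` (nbrs G u \<inter> nbrs G v) = e ` nbrs G u \<inter> e ` nbrs G v"
        using e nbrs_subset[OF delete_edge(1)] by (intro inj_on_image_Int) auto
      then have "induced (map_graph e G) (nbrs (map_graph e G) (e u) \<inter> nbrs (map_graph e G) (e v)) =
          map_graph e (induced G (nbrs G u \<inter> nbrs G v))"
        using uv n by (simp add: nbrs_map_graph[OF delete_edge(1) e]
          map_graph_induced[OF delete_edge(1) e n])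
      then show "contractible (induced (map_graph e G) (nbrs (map_graph e G) (e u) \<inter> nbrs (map_graph e G) (e v)))"
        using delete_edge e by (auto intro: inj_on_subset)
    qed (use delete_edge(2) digital_map_graph[OF delete_edge(1) e] in force)+
    ultimately show "contractible (map_graph e G)" using step by metis
  qed
next
  case (add_edge G u v)
  show ?case
  proof (intro impI allI)
    fix e :: "'a \<Rightarrow> 'b" assume e: "inj_on e (points G)"
      and IH: "\<forall>e :: 'a \<Rightarrow> 'b. inj_on e (points (add_edge G u v)) \<longrightarrow> contractible (map_graph e (add_edge G u v))"
    have "map_graph e (add_edge G u v) = add_edge (map_graph e G) (e u) (e v)"
      by (intro graph_eqI) (auto simp: add_edge_def)
    moreover have "contractible (map_graph e (add_edge G u v))"
      using IH e by (auto simp: add_edge_def)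
    moreover have "contractible_transformation (map_graph e G) (add_edge (map_graph e G) (e u) (e v))"
    proof (rule contractible_contractible_transformation.add_edge)
      have n: "nbrs G u \<inter> nbrs G v \<subseteq> points G" using nbrs_subset[OF add_edge(1)] by blast
      have "e ` (nbrs G u \<inter> nbrs G v) = e ` nbrs G u \<inter> e ` nbrs G v"
        using e nbrs_subset[OF add_edge(1)] by (intro inj_on_image_Int) auto
      then have "induced (map_graph e G) (nbrs (map_graph e G) (e u) \<inter> nbrs (map_graph e G) (e v)) =
          map_graph e (induced G (nbrs G u \<inter> nbrs G v))"
        using add_edge(2,3) n by (simp add: nbrs_map_graph[OF add_edge(1) e]
          map_graph_induced[OF add_edge(1) e n])
      then show "contractible (induced (map_graph e G) (nbrs (map_graph e G) (e u) \<inter> nbrs (map_graph e G) (e v)))"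
        using add_edge e by (auto intro: inj_on_subset)
      show "(e u, e v) \<notin> adj (map_graph e G)"
        using adj_map_graph_iff[OF add_edge(1) e add_edge(2,3)] add_edge(5) by simp
      show "e u \<noteq> e v" using e add_edge(2-4) by (auto dest: inj_onD)
    qed (use add_edge(2,3) digital_map_graph[OF add_edge(1) e] in auto)
    ultimately show "contractible (map_graph e G)" using step by metis
  qed
qed

lemma contractible_map_graph:
  assumes "digital_space G" "inj_on e (points G)"
  shows "contractible (map_graph e G) \<longleftrightarrow> contractible G"
proof
  assume "contractible (map_graph e G)"
  moreover have "inj_on (inv_into (points G) e) (points (map_graph e G))"
    by (simp add: inj_on_inv_into)
  ultimately have "contractible (map_graph (inv_into (points G) e) (map_graph e G))"
    using contractible_map_graph_aux(1) by blast
  then show "contractible G" by (simp add: map_graph_inv[OF assms])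
qed (use contractible_map_graph_aux(1) assms in blast)

section \<open>Spheres as manifolds with contractible point complements\<close>

text \<open>
  This replaces the gluing of two disks in the definition of spheres; \<open>sphere_imp_sphere_like\<close> and
  \<open>sphere_like_imp_sphere\<close> prove the equivalence. Here \<open>manifold_like n\<close> corresponds to closed
  manifolds of dimension \<open>Suc n\<close>.
\<close>

primrec sphere_like :: "nat \<Rightarrow> 'a::infinite graph \<Rightarrow> bool" where
  "sphere_like 0 G \<longleftrightarrow> (\<exists>a b. a \<noteq> b \<and> G = \<lparr>points = {a, b}, adj = {}\<rparr>)"
| "sphere_like (Suc n) G \<longleftrightarrow> digital_space G \<and> connected_graph G \<and> (\<forall>v \<in> points G. sphere_like n (rim G v)) \<and>
     (\<exists>v \<in> points G. contractible (delete_points G {v}))"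

definition manifold_like :: "nat \<Rightarrow> 'a::infinite graph \<Rightarrow> bool" where
  "manifold_like n G \<longleftrightarrow> digital_space G \<and> connected_graph G \<and> (\<forall>v \<in> points G. sphere_like n (rim G v))"

lemma sphere_like_Suc_iff:
  "sphere_like (Suc n) G \<longleftrightarrow> manifold_like n G \<and> (\<exists>v \<in> points G. contractible (delete_points G {v}))"
  by (auto simp: manifold_like_def)

lemma digital_sphere_like: "sphere_like n G \<Longrightarrow> digital_space G"
  by (cases n) (auto simp: digital_space_def sym_def irrefl_def)

lemma sphere_like_nonempty: "sphere_like n G \<Longrightarrow> points G \<noteq> {}"
  by (cases n) auto

text \<open>Invariance of the rims is an assumption here because it is the induction hypothesis when
  the dimension of spheres is raised.\<close>

lemma manifold_like_map_graph_aux: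
  assumes "\<And>v. v \<in> points G \<Longrightarrow> sphere_like n (rim (map_graph e G) (e v)) \<longleftrightarrow> sphere_like n (rim G v)"
    "digital_space G" "inj_on e (points G)"
  shows "manifold_like n (map_graph e G) \<longleftrightarrow> manifold_like n G"
proof -
  have "connected_graph (map_graph e G) \<longleftrightarrow> connected_graph G"
    using connected_map_graph[OF assms(2,3)] connected_map_graph[OF digital_map_graph[OF assms(2,3)],
        of "inv_into (points G) e"] map_graph_inv[OF assms(2,3)]
    by (auto simp: inj_on_inv_into)
  then show ?thesis using assms digital_map_graph[OF assms(2,3)] by (auto simp: manifold_like_def)
qed

lemma sphere_like_map_graph:
  assumes "digital_space G" "inj_on e (points G)"
  shows "sphere_like n (map_graph e G) \<longleftrightarrow> sphere_like n G"
  using assms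
proof (induction n arbitrary: G)
  case 0
  have *: "sphere_like 0 (map_graph e G)" if h: "sphere_like 0 G" and i: "inj_on e (points G)"
    for e :: "'c::infinite \<Rightarrow> 'd::infinite" and G
  proof -
    obtain a b where "a \<noteq> b" "G = \<lparr>points = {a, b}, adj = {}\<rparr>" using h by auto
    then have "e a \<noteq> e b \<and> map_graph e G = \<lparr>points = {e a, e b}, adj = {}\<rparr>"
      using i by (auto simp: map_graph_def)
    then show ?thesis unfolding sphere_like.simps by blast
  qed
  show ?case
    using *[of G e] *[of "map_graph e G" "inv_into (points G) e"] 0
    by (auto simp: map_graph_inv inj_on_inv_into)
next
  case (Suc n)
  have "sphere_like n (rim (map_graph e G) (e v)) \<longleftrightarrow> sphere_like n (rim G v)" if "v \<in> points G" for v
    using that Suc by (auto simp: rim_map_graph intro!: Suc.IH intro: inj_on_subset)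
  then have manifold_like: "manifold_like n (map_graph e G) \<longleftrightarrow> manifold_like n G" using Suc.prems
    by (intro manifold_like_map_graph_aux)
  have "contractible (delete_points (map_graph e G) {e v}) \<longleftrightarrow> contractible (delete_points G {v})"
    if "v \<in> points G" for v
    using delete_points_map_graph[OF Suc.prems, of "{v}"] that Suc.prems
    by (auto simp: intro!: contractible_map_graph intro: inj_on_subset)
  then show ?case unfolding sphere_like_Suc_iff manifold_like by auto
qed

lemma manifold_like_map_graph:
  assumes "digital_space G" "inj_on e (points G)"
  shows "manifold_like n (map_graph e G) \<longleftrightarrow> manifold_like n G"
proof (rule manifold_like_map_graph_aux[OF _ assms])
  fix v assume v: "v \<in> points G"
  have "sphere_like n (map_graph e (rim G v)) \<longleftrightarrow> sphere_like n (rim G v)"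
    by (rule sphere_like_map_graph) (use assms in \<open>auto simp: inj_on_def\<close>)
  then show "sphere_like n (rim (map_graph e G) (e v)) \<longleftrightarrow> sphere_like n (rim G v)"
    using v by (simp add: rim_map_graph[OF assms])
qed

lemma contractible_delete_point_adj:
  assumes "digital_space G" "(u, v) \<in> adj G" "contractible (delete_points (rim G v) {u})"
  shows "contractible (delete_points G {u, v}) \<longleftrightarrow> contractible (delete_points G {u})"
proof -
  note uv = digital_adjD[OF assms(1,2)]
  have "delete_points (delete_points G {u}) {v} = delete_points G {u, v}"
    by (rule graph_eqI) auto
  then show ?thesis
    using contractible_delete_point_iff[of "delete_points G {u}" v] uv assms
    by (auto simp: rim_delete_points)
qed

lemma sphere_like_delete_point_contractible:
  "sphere_like n G \<Longrightarrow> v \<in> points G \<Longrightarrow> contractible (delete_points G {v})"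
proof (induction n arbitrary: G v)
  case 0
  then obtain a b where "a \<noteq> b" "G = \<lparr>points = {a, b}, adj = {}\<rparr>" by auto
  then have "delete_points G {v} = one_point (if v = a then b else a)"
    using 0(2) by (intro graph_eqI) auto
  then show ?case by (simp add: one_point)
next
  case (Suc n)
  have ds: "digital_space G" and c: "connected_graph G" using Suc by auto
  obtain w where w: "w \<in> points G" "contractible (delete_points G {w})" using Suc by auto
  let ?S = "{x \<in> points G. contractible (delete_points G {x})}"
  have "?S = points G"
  proof (rule connected_graphD[OF c ds])
    fix x y assume x: "x \<in> ?S" and xy: "(x, y) \<in> adj G"
    note yx = digital_adjD[OF ds xy]
    have "contractible (delete_points (rim G y) {x})" "contractible (delete_points (rim G x) {y})"
      using Suc xy yx by (auto intro!: Suc.IH)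
    then show "y \<in> ?S"
      using contractible_delete_point_adj[OF ds xy] contractible_delete_point_adj[OF ds yx(1)] x yx
      by (simp add: insert_commute)
  qed (use w in auto)
  then show ?case using Suc.prems(2) by auto
qed

text \<open>A contractible point complement is finite. This gives the finiteness demanded of
  1-spheres and leaves fresh points available for disjoint copies.\<close>

lemma finite_sphere_like: "sphere_like n G \<Longrightarrow> finite (points G)"
  using sphere_like_nonempty[of n G] sphere_like_delete_point_contractible[of n G] contractible_finite by fastforce

text \<open>At a point \<open>x\<close> of \<open>S\<close> the rim within \<open>S\<close> is a
  sphere inside the rim of \<open>x\<close> in \<open>G\<close>, of the same dimension, so by
  induction they coincide. Hence \<open>S\<close> is closed under adjacency and connectedness of
  \<open>G\<close> makes it everything.\<close>

lemma sphere_like_rigid: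
  assumes "sphere_like n G" "sphere_like n (induced G S)" "S \<subseteq> points G"
  shows "S = points G"
  using assms
proof (induction n arbitrary: G S)
  case 0
  obtain a b where G: "points G = {a, b}" using 0(1) by auto
  obtain a' b' where "a' \<noteq> b'" "induced G S = \<lparr>points = {a', b'}, adj = {}\<rparr>" using 0(2) by auto
  then have "a' \<noteq> b'" "points (induced G S) = {a', b'}" by simp_all
  then have "S = {a', b'}" using 0(3) by auto
  then show ?case using 0(3) G \<open>a' \<noteq> b'\<close> by auto
next
  case (Suc n)
  have ds: "digital_space G" using Suc digital_sphere_like by blast
  have c: "connected_graph G" using Suc.prems(1) by simp
  show ?case
  proof (rule connected_graphD[OF c ds Suc.prems(3)])
    show "S \<noteq> {}" using sphere_like_nonempty[OF Suc.prems(2)] by auto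
    fix x y assume x: "x \<in> S" and xy: "(x, y) \<in> adj G"
    have "x \<in> points G" using x Suc.prems(3) by blast
    then have "sphere_like n (rim G x)" "sphere_like n (rim (induced G S) x)" using Suc.prems x
      by simp_all
    moreover have "rim (induced G S) x = induced (rim G x) (S \<inter> nbrs G x)"
      unfolding rim_induced[OF x] by (simp add: rim_def Int_ac)
    moreover have "S \<inter> nbrs G x \<subseteq> points (rim G x)" using Suc.prems(3) by auto
    ultimately have "S \<inter> nbrs G x = points (rim G x)" by (metis Suc.IH)
    moreover have "y \<in> points (rim G x)" using xy digital_adjD(3)[OF ds xy] by simp
    ultimately show "y \<in> S" by blast
  qed
qed

text \<open>The rim of a neighbour \<open>x\<close> of \<open>v\<close> is a smaller sphere
  containing \<open>v\<close>; a point of it not adjacent to \<open>v\<close> serves for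
  \<open>G\<close> too.\<close>

lemma sphere_like_not_cone:
  assumes "sphere_like n G" "v \<in> points G"
  shows "\<exists>p \<in> points G. p \<noteq> v \<and> (v, p) \<notin> adj G"
  using assms
proof (induction n arbitrary: G)
  case (Suc n)
  have ds: "digital_space G" using Suc digital_sphere_like by blast
  have "sphere_like n (rim G v)" using Suc by auto
  then obtain x where x: "x \<in> nbrs G v" using sphere_like_nonempty by fastforce
  then have vx: "(v, x) \<in> adj G" by simp
  note xv = digital_adjD[OF ds vx]
  obtain p where "p \<in> points (rim G x)" "p \<noteq> v" "(v, p) \<notin> adj (rim G x)"
    using Suc.IH[of "rim G x"] Suc.prems xv by auto
  then show ?case using xv by (auto simp: rim_def)
qed auto

section \<open>Exchanging a point and the interior of a disk\<close>

text \<open>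
  The graph induced on \<open>A\<close>, \<open>v\<close> and the neighbours of \<open>v\<close> is a sphere, so the complement of \<open>v\<close>
  in it is a disk with interior \<open>A\<close> whose boundary is the rim of \<open>v\<close> in \<open>W\<close>.
\<close>

definition exchange :: "nat \<Rightarrow> 'a::infinite graph \<Rightarrow> 'a \<Rightarrow> 'a set \<Rightarrow> bool" where
  "exchange n W v A \<longleftrightarrow> digital_space W \<and> v \<in> points W \<and> A \<subseteq> points W \<and> v \<notin> A \<and> A \<inter> nbrs W v = {} \<and>
     (\<forall>a \<in> A. nbrs W a \<subseteq> A \<union> nbrs W v) \<and> sphere_like n (induced W (insert v (A \<union> nbrs W v)))"

text \<open>Both complements arise from one auxiliary graph by deleting points with contractible
  rims: \<open>v\<close> alone for one of them, the points of \<open>A\<close> one at a time for the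
  other.\<close>

lemma exchange_contractible:
  assumes W: "digital_space W" "v \<in> points W" "A \<subseteq> points W" "v \<notin> A" "A \<inter> nbrs W v = {}"
    "\<And>a. a \<in> A \<Longrightarrow> nbrs W a \<subseteq> A \<union> nbrs W v"
    and D: "contractible (induced W (A \<union> nbrs W v))"
  shows "contractible (delete_points W {v}) \<longleftrightarrow> contractible (delete_points W A)"
proof -
  \<comment> \<open>In \<open>W'\<close> the rim of \<open>v\<close> is the whole disk and the rims of the points of \<open>A\<close> are cones with apex \<open>v\<close>.\<close>
  define W' where "W' = \<lparr>points = points W, adj = adj W \<union> {v} \<times> A \<union> A \<times> {v}\<rparr>"
  have p: "points W' = points W" and adj: "adj W' = adj W \<union> {v} \<times> A \<union> A \<times> {v}"
    by (simp_all add: W'_def)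
  have ds: "digital_space W'"
    using W(1-4) by (auto simp: digital_space_def sym_def irrefl_def p adj)
  have sub: "A \<union> nbrs W v \<subseteq> points W" using W(3) nbrs_subset[OF W(1)] by blast
  have fin: "finite (A \<union> nbrs W v)" using contractible_finite[OF D] sub by (simp add: Int_absorb1)
  have "rim W' v = induced W (A \<union> nbrs W v)"
    using W(4) not_adj_self[OF W(1), of v] by (intro graph_eqI) (auto simp: rim_def p adj)
  moreover have "delete_points W' {v} = delete_points W {v}"
    by (rule graph_eqI) (auto simp: p adj)
  ultimately have 1: "contractible (delete_points W {v}) \<longleftrightarrow> contractible W'"
    using contractible_delete_point_iff[OF ds] W(2) D p by metis
  \<comment> \<open>After some points of \<open>A\<close> are gone, the rim of the next one is still
    a cone with apex \<open>v\<close>, so the deletions can continue.\<close>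
  have 2: "contractible (delete_points W' T) \<longleftrightarrow> contractible W'" if "finite T" "T \<subseteq> A" for T
    using that
  proof (induction T rule: finite_induct)
    case empty
    have "delete_points W' {} = W'" using digital_adjD(2,3)[OF ds] by (intro graph_eqI) auto
    then show ?case by simp
  next
    case (insert a T)
    let ?G = "delete_points W' T"
    have a: "a \<in> A" "a \<notin> T" "a \<noteq> v" "a \<in> points W" "v \<notin> T" using insert W(3,4) by auto
    have "contractible (rim ?G a)"
    proof (rule contractible_cone[where v = v])
      have "nbrs ?G a \<subseteq> insert v (A \<union> nbrs W v)"
        using W(6)[OF a(1)] by (auto simp: adj)
      then have "points (rim ?G a) \<subseteq> insert v (A \<union> nbrs W v)" by auto
      then show "finite (points (rim ?G a))" using fin by (meson finite_insert finite_subset)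
      show "v \<in> points (rim ?G a)" using a W(2) by (simp add: p adj)
      fix x assume x: "x \<in> points (rim ?G a)" "x \<noteq> v"
      then have "(a, x) \<in> adj W" "x \<in> points W" "x \<notin> T" using a by (auto simp: adj p)
      moreover from this have "x \<in> A \<union> nbrs W v" using W(6)[OF a(1)] by auto
      ultimately show "(v, x) \<in> adj (rim ?G a)"
        using a x(2) W(2) by (auto simp: rim_def adj p)
    qed (use ds in simp)
    moreover have "delete_points ?G {a} = delete_points W' (insert a T)"
      by (rule graph_eqI) auto
    ultimately show ?case
      using contractible_delete_point_iff[of ?G a] ds a insert.IH insert.prems by (simp add: p)
  qed
  have "delete_points W' A = delete_points W A"
    by (rule graph_eqI) (auto simp: p adj)
  then show ?thesis using 1 2[of A] fin by simp
qed

text \<open>A closed set of one complement becomes a closed set of the other when \<open>v\<close>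
  is traded for \<open>A\<close>. For this it has to contain \<open>v\<close>, respectively the
  whole disk.\<close>

lemma exchange_connected:
  assumes W: "digital_space W" "v \<in> points W" "A \<subseteq> points W" "v \<notin> A" "A \<inter> nbrs W v = {}"
    "\<And>a. a \<in> A \<Longrightarrow> nbrs W a \<subseteq> A \<union> nbrs W v"
    and D: "connected_graph (induced W (A \<union> nbrs W v))"
  shows "connected_graph (delete_points W {v}) \<longleftrightarrow> connected_graph (delete_points W A)"
proof -
  have sub: "nbrs W v \<subseteq> points W" using nbrs_subset[OF W(1)] by blast
  have sub': "A \<union> nbrs W v \<subseteq> points W" using sub W(3) by blast
  have ne: "A \<union> nbrs W v \<noteq> {}" using connected_graph_nonempty[OF D] by auto
  have vv: "v \<notin> nbrs W v" using W(1) by simp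
  have sym: "(y, x) \<in> adj W" if "(x, y) \<in> adj W" for x y using digital_adjD(1)[OF W(1) that] .
  have AB: "y \<in> A \<union> nbrs W v" if "x \<in> A" "(x, y) \<in> adj W" for x y
    using W(6)[OF that(1)] that(2) by auto
  have pts: "x \<in> points W" "y \<in> points W" if "(x, y) \<in> adj W" for x y
    using digital_adjD(2,3)[OF W(1) that] .
  show ?thesis
  proof
    assume c: "connected_graph (delete_points W {v})"
    show "connected_graph (delete_points W A)"
    proof (rule connected_graphI)
      fix S assume S: "S \<subseteq> points (delete_points W A)" "S \<noteq> {}"
        "\<And>x y. x \<in> S \<Longrightarrow> (x, y) \<in> adj (delete_points W A) \<Longrightarrow> y \<in> S"
      have cl: "y \<in> S" if "x \<in> S" "(x, y) \<in> adj W" "y \<notin> A" for x y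
        using S(3)[of x y] S(1) that pts[OF that(2)] by auto
      \<comment> \<open>Without \<open>v\<close> the set \<open>S\<close> has no neighbour of
        \<open>v\<close>, hence no neighbour of a point of \<open>A\<close>. It would be closed in
        \<open>W\<close> without \<open>v\<close> and so be all of it, although it misses the
        nonempty disk.\<close>
      have "v \<in> S"
      proof (rule ccontr)
        assume v: "v \<notin> S"
        then have SB: "x \<notin> nbrs W v" if "x \<in> S" for x
          using cl[OF that, of v] W(4) sym by auto
        have "S = points (delete_points W {v})"
        proof (rule connected_graphD[OF c])
          fix x y assume x: "x \<in> S" and "(x, y) \<in> adj (delete_points W {v})"
          then have xy: "(x, y) \<in> adj W" by simp
          have "y \<notin> A" using AB[OF _ sym[OF xy]] SB[OF x] x S(1) by auto
          then show "y \<in> S" using cl x xy by blast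
        qed (use S v W(1) in auto)
        moreover from this have "x \<notin> nbrs W v" for x
          using SB[of x] sub vv by (metis DiffI delete_points_simps(1) singletonD subsetD)
        ultimately show False using ne sub' S(1) W(4) by auto
      qed
      let ?T = "(S - {v}) \<union> A"
      have B: "nbrs W v \<subseteq> S" using cl[OF \<open>v \<in> S\<close>] W(5) by (metis disjoint_iff nbrs_iff subsetI)
      have "?T = points (delete_points W {v})"
      proof (rule connected_graphD[OF c])
        show "?T \<noteq> {}" using ne B vv by auto
        show "?T \<subseteq> points (delete_points W {v})" using S(1) W(3,4) by auto
        fix x y assume x: "x \<in> ?T" and "(x, y) \<in> adj (delete_points W {v})"
        then have xy: "(x, y) \<in> adj W" "y \<noteq> v" by auto
        then show "y \<in> ?T" using x cl[of x y] AB[of x y] B by auto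
      qed (use W(1) in auto)
      then show "points (delete_points W A) \<subseteq> S" using \<open>v \<in> S\<close> by auto
    qed (use W in auto)
  next
    assume c: "connected_graph (delete_points W A)"
    show "connected_graph (delete_points W {v})"
    proof (rule connected_graphI)
      show "points (delete_points W {v}) \<noteq> {}" using ne sub' vv W(4) by auto
      fix S assume S: "S \<subseteq> points (delete_points W {v})" "S \<noteq> {}"
        "\<And>x y. x \<in> S \<Longrightarrow> (x, y) \<in> adj (delete_points W {v}) \<Longrightarrow> y \<in> S"
      have cl: "y \<in> S" if "x \<in> S" "(x, y) \<in> adj W" "y \<noteq> v" for x y
        using S(3)[of x y] S(1) that pts[OF that(2)] by auto
      \<comment> \<open>A set missing the disk has no point adjacent to \<open>v\<close>. It would
        be closed in \<open>W\<close> without \<open>A\<close> and therefore contain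
        \<open>v\<close>.\<close>
      have "S \<inter> (A \<union> nbrs W v) \<noteq> {}"
      proof
        assume SD: "S \<inter> (A \<union> nbrs W v) = {}"
        have "S = points (delete_points W A)"
        proof (rule connected_graphD[OF c])
          fix x y assume x: "x \<in> S" and "(x, y) \<in> adj (delete_points W A)"
          then have xy: "(x, y) \<in> adj W" by simp
          have "y \<noteq> v" using SD x sym[OF xy] by auto
          then show "y \<in> S" using cl x xy by blast
        qed (use S SD W(1) in auto)
        then show False using W(2,4) S(1) by auto
      qed
      then have "S \<inter> (A \<union> nbrs W v) = points (induced W (A \<union> nbrs W v))"
      proof (intro connected_graphD[OF D])
        fix x y assume x: "x \<in> S \<inter> (A \<union> nbrs W v)"
          and "(x, y) \<in> adj (induced W (A \<union> nbrs W v))"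
        then have "(x, y) \<in> adj W" "y \<in> A \<union> nbrs W v" by simp_all
        moreover from this have "y \<noteq> v" using vv W(4) by auto
        ultimately show "y \<in> S \<inter> (A \<union> nbrs W v)" using cl[of x y] x by simp
      qed (use sub' W(1) in auto)
      then have D_sub: "A \<union> nbrs W v \<subseteq> S" using sub' by auto
      let ?T = "insert v (S - A)"
      have "?T = points (delete_points W A)"
      proof (rule connected_graphD[OF c])
        show "?T \<subseteq> points (delete_points W A)" using S(1) W(2-4) by auto
        fix x y assume x: "x \<in> ?T" and "(x, y) \<in> adj (delete_points W A)"
        then have xy: "(x, y) \<in> adj W" "y \<notin> A" by auto
        then show "y \<in> ?T" using x cl[of x y] D_sub by auto
      qed (use W(1) in auto)
      then show "points (delete_points W {v}) \<subseteq> S" using D_sub by auto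
    qed (use W in auto)
  qed
qed

lemma rim_delete_points': "digital_space G \<Longrightarrow> x \<in> points G \<Longrightarrow> x \<notin> A \<Longrightarrow>
    rim (delete_points G A) x = induced G (nbrs G x - A)"
  using nbrs_subset[of G x] by (intro graph_eqI) (auto simp: rim_def)

lemma exchange_K:
  assumes "exchange n W v A"
  defines "K \<equiv> induced W (insert v (A \<union> nbrs W v))"
  shows "points K = insert v (A \<union> nbrs W v)" "delete_points K {v} = induced W (A \<union> nbrs W v)"
    "nbrs K v = nbrs W v" "a \<in> A \<Longrightarrow> nbrs K a = nbrs W a"
proof -
  have e: "digital_space W" "v \<in> points W" "A \<subseteq> points W" "v \<notin> A"
    "\<And>a. a \<in> A \<Longrightarrow> nbrs W a \<subseteq> A \<union> nbrs W v"
    using assms(1) by (auto simp: exchange_def)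
  have vv: "v \<notin> nbrs W v" using e(1) by simp
  show "points K = insert v (A \<union> nbrs W v)"
    using e(2,3) nbrs_subset[OF e(1), of v] by (simp add: K_def Int_absorb1)
  show "delete_points K {v} = induced W (A \<union> nbrs W v)"
    unfolding K_def using e vv digital_adjD(2,3)[OF e(1)] by (intro graph_eqI) auto
  show "nbrs K v = nbrs W v" by (auto simp: K_def)
  show "nbrs K a = nbrs W a" if "a \<in> A"
    using that e(5)[OF that] by (auto simp: K_def)
qed

text \<open>In the closed-up disk the rim of \<open>x\<close> is a sphere of one dimension less. It
  is also the closed-up disk required for an exchange inside \<open>rim W x\<close>.\<close>

lemma exchange_rim:
  assumes "exchange (Suc n) W v A" "(v, x) \<in> adj W"
  shows "exchange n (rim W x) v (A \<inter> nbrs W x)"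
proof -
  have e: "digital_space W" "v \<in> points W" "A \<subseteq> points W" "v \<notin> A" "A \<inter> nbrs W v = {}"
    "\<And>a. a \<in> A \<Longrightarrow> nbrs W a \<subseteq> A \<union> nbrs W v"
    "sphere_like (Suc n) (induced W (insert v (A \<union> nbrs W v)))"
    using assms(1) by (auto simp: exchange_def)
  note vx = digital_adjD[OF e(1) assms(2)]
  have n: "nbrs (rim W x) v = nbrs W x \<inter> nbrs W v" by (rule nbrs_rim[OF vx(1)])
  have "sphere_like n (rim (induced W (insert v (A \<union> nbrs W v))) x)"
    using e(7) assms(2) vx(3) by simp
  also have "rim (induced W (insert v (A \<union> nbrs W v))) x =
      induced (rim W x) (insert v (A \<inter> nbrs W x \<union> nbrs (rim W x) v))"
    unfolding n using assms(2) vx(1)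
    by (subst rim_induced) (auto simp: rim_def intro!: arg_cong[of _ _ "induced W"])
  finally have "sphere_like n (induced (rim W x) (insert v (A \<inter> nbrs W x \<union> nbrs (rim W x) v)))" .
  moreover have "nbrs (rim W x) a \<subseteq> A \<inter> nbrs W x \<union> nbrs (rim W x) v" if "a \<in> A \<inter> nbrs W x" for a
    unfolding n using e(6)[of a] that nbrs_rim[of x a W] by auto
  ultimately show ?thesis
    unfolding exchange_def using e(1-5) vx n by auto
qed

lemma exchange_connected_iff:
  assumes ex: "exchange (Suc n) W v A"
  shows "connected_graph (delete_points W {v}) \<longleftrightarrow> connected_graph (delete_points W A)"
proof -
  let ?K = "induced W (insert v (A \<union> nbrs W v))"
  note K = exchange_K[OF ex]
  have e: "digital_space W" "v \<in> points W" "A \<subseteq> points W" "v \<notin> A" "A \<inter> nbrs W v = {}"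
    "\<And>a. a \<in> A \<Longrightarrow> nbrs W a \<subseteq> A \<union> nbrs W v" "sphere_like (Suc n) ?K"
    using ex by (auto simp: exchange_def)
  have "contractible (delete_points ?K {v})"
    using sphere_like_delete_point_contractible[OF e(7)] K(1) by blast
  then have "connected_graph (induced W (A \<union> nbrs W v))"
    unfolding K(2) by (rule contractible_transformation_connected(1))
  then show ?thesis
    by (rule exchange_connected[OF e(1-5), rotated]) (rule e(6))
qed

text \<open>The points of \<open>A\<close> and the point \<open>v\<close> each occur on one side
  only, where their rims are those in the sphere \<open>?K\<close>. The statement on spheres of
  lower dimension is an assumption, since this lemma serves inside the induction that proves
  it.\<close>

lemma exchange_manifold_like_aux:
  assumes ex: "exchange (Suc n) W v A"
    and IH: "\<And>W :: 'a::infinite graph. \<And>v A. exchange n W v A \<Longrightarrow>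
      sphere_like n (delete_points W {v}) \<longleftrightarrow> sphere_like n (delete_points W A)"
  shows "manifold_like n (delete_points W {v}) \<longleftrightarrow> manifold_like n (delete_points (W :: 'a graph) A)"
proof -
  let ?K = "induced W (insert v (A \<union> nbrs W v))"
  note K = exchange_K[OF ex]
  have e: "digital_space W" "v \<in> points W" "A \<subseteq> points W" "v \<notin> A" "A \<inter> nbrs W v = {}"
    "\<And>a. a \<in> A \<Longrightarrow> nbrs W a \<subseteq> A \<union> nbrs W v" "sphere_like (Suc n) ?K"
    using ex by (auto simp: exchange_def)
  note con = exchange_connected_iff[OF ex]
  have hsK: "sphere_like n (rim ?K x)" if "x \<in> points ?K" for x using e(7) that by simp
  have ha: "sphere_like n (rim (delete_points W {v}) a)" if "a \<in> A" for a
  proof -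
    have "a \<noteq> v" "(a, v) \<notin> adj W" "a \<in> points W" using that e digital_adjD(1)[OF e(1)] by auto
    moreover from this have "nbrs W a - {v} = nbrs W a" by auto
    ultimately have "rim (delete_points W {v}) a = rim W a"
      using e(1) by (simp add: rim_delete_points') (simp add: rim_def)
    also have "\<dots> = rim ?K a"
      using e(6)[OF that] that by (subst rim_induced) (auto
        simp: rim_def intro!: arg_cong[of _ _ "induced W"])
    finally show ?thesis using hsK K(1) that by (metis UnI1 insertI2)
  qed
  have hv: "sphere_like n (rim (delete_points W A) v)"
  proof -
    have "nbrs W v - A = nbrs W v" using e(5) by blast
    then have "rim (delete_points W A) v = rim W v"
      using e(1,2,4) by (simp add: rim_delete_points') (simp add: rim_def)
    also have "\<dots> = rim ?K v"
      by (subst rim_induced) (auto simp: rim_def intro!: arg_cong[of _ _ "induced W"])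
    finally show ?thesis using hsK K(1) by (metis insertI1)
  qed
  have hx: "sphere_like n (rim (delete_points W {v}) x) \<longleftrightarrow> sphere_like n (rim (delete_points W A) x)"
    if x: "x \<in> points W" "x \<noteq> v" "x \<notin> A" for x
  proof (cases "(v, x) \<in> adj W")
    case True
    have "delete_points (rim W x) (A \<inter> nbrs W x) = delete_points (rim W x) A"
      by (rule graph_eqI) (auto simp: rim_def)
    then show ?thesis
      using IH[OF exchange_rim[OF ex True]] x e(1) by (simp add: rim_delete_points)
  next
    case False
    \<comment> \<open>The neighbours of a point of \<open>A\<close> lie in \<open>A\<close> or in
      the rim of \<open>v\<close>, and \<open>x\<close> is in neither, so both deletions leave its
      rim unchanged.\<close>
    then have "nbrs W x - {v} = nbrs W x" "nbrs W x - A = nbrs W x"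
      using digital_adjD(1)[OF e(1)] e(6) x(3) by fastforce+
    then show ?thesis using x e(1) by (simp add: rim_delete_points')
  qed
  show ?thesis
    unfolding manifold_like_def con using ha hv hx e(1)
      by (metis DiffD1 DiffD2 DiffI delete_points_simps(1)
        digital_delete_points singletonD singletonI)
qed

lemma sphere_like_0_iff: "sphere_like 0 G \<longleftrightarrow> card (points G) = 2 \<and> adj G = {}"
  by (cases G) (auto simp: card_2_iff)

lemma exchange_sphere_like:
  "exchange n W v A \<Longrightarrow> sphere_like n (delete_points W {v}) \<longleftrightarrow> sphere_like n (delete_points W A)"
proof (induction n arbitrary: W v A)
  case 0
  let ?K = "induced W (insert v (A \<union> nbrs W v))"
  have e: "digital_space W" "v \<in> points W" "A \<subseteq> points W" "v \<notin> A" "A \<inter> nbrs W v = {}"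
    "\<And>a. a \<in> A \<Longrightarrow> nbrs W a \<subseteq> A \<union> nbrs W v" "sphere_like 0 ?K"
    using 0 by (auto simp: exchange_def)
  note K = exchange_K[OF 0]
  \<comment> \<open>A 0-sphere has two points and no edge, so \<open>A\<close> is a single point,
    and it and \<open>v\<close> are both isolated in \<open>W\<close>.\<close>
  have adjK: "adj ?K = {}" using e(7) unfolding sphere_like_0_iff by blast
  have nv: "nbrs W v = {}" using K(3) adjK by auto
  have na: "nbrs W a = {}" if "a \<in> A" for a using K(4)[OF that] adjK by auto
  have "card (insert v A) = 2" using e(7) K(1) nv unfolding sphere_like_0_iff by simp
  moreover from this have "finite A" by (metis card.infinite finite_insert zero_neq_numeral)
  ultimately have "card A = 1" using e(4) by simp
  then obtain a where A: "A = {a}" by (rule card_1_singletonE)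
  have "adj (delete_points W {v}) = adj W" "adj (delete_points W A) = adj W"
    using nv na[of a] A digital_adjD(2,3)[OF e(1)] digital_adjD(1)[OF e(1), of _ v]
      digital_adjD(1)[OF e(1), of _ a] by (auto simp: set_eq_iff)
  then show ?case using e(2,3) A unfolding sphere_like_0_iff by simp
next
  case (Suc n)
  let ?K = "induced W (insert v (A \<union> nbrs W v))"
  have e: "digital_space W" "v \<in> points W" "A \<subseteq> points W" "v \<notin> A" "A \<inter> nbrs W v = {}"
    "\<And>a. a \<in> A \<Longrightarrow> nbrs W a \<subseteq> A \<union> nbrs W v" "sphere_like (Suc n) ?K"
    using Suc.prems by (auto simp: exchange_def)
  note K = exchange_K[OF Suc.prems]
  have manifold_like: "manifold_like n (delete_points W {v}) \<longleftrightarrow> manifold_like n (delete_points W A)"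
    using Suc by (intro exchange_manifold_like_aux)
  have contr: "contractible (delete_points W {v, p}) \<longleftrightarrow> contractible (delete_points W (insert p A))"
    if p: "p \<in> points W" "p \<notin> A" "p \<noteq> v" "(v, p) \<notin> adj W" for p
  proof -
    let ?G = "delete_points W {p}"
    have "contractible (delete_points ?K {v})"
      using sphere_like_delete_point_contractible[OF e(7)] K(1) by blast
    moreover have nb: "nbrs ?G v = nbrs W v" using p e(2) digital_adjD(3)[OF e(1)] by auto
    moreover have "induced W (A \<union> nbrs W v) = induced ?G (A \<union> nbrs W v)"
      using p digital_adjD(2,3)[OF e(1)] by (intro graph_eqI) auto
    ultimately have "contractible (induced ?G (A \<union> nbrs ?G v))" by (simp add: K(2))
    then have "contractible (delete_points ?G {v}) \<longleftrightarrow> contractible (delete_points ?G A)"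
      using e p nb by (intro exchange_contractible) (auto simp: subset_iff)
    moreover have "delete_points ?G {v} = delete_points W {v, p}"
      "delete_points ?G A = delete_points W (insert p A)"
      by (rule graph_eqI; auto)+
    ultimately show ?thesis by simp
  qed
  have dd: "delete_points (delete_points W S) T = delete_points W (S \<union> T)" for S T
    by (rule graph_eqI) auto
  show ?case
  proof
    assume h: "sphere_like (Suc n) (delete_points W {v})"
    \<comment> \<open>If there were no such point, \<open>W\<close> would be the sphere
      \<open>?K\<close>, with the sphere obtained by deleting \<open>v\<close> as a proper induced
      part, against rigidity.\<close>
    have "\<exists>p \<in> points W. p \<notin> A \<and> p \<noteq> v \<and> (v, p) \<notin> adj W"
    proof (rule ccontr)
      assume "\<not> ?thesis"
      then have "insert v (A \<union> nbrs W v) = points W"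
        using e(2,3) nbrs_subset[OF e(1)] by auto
      then have "sphere_like (Suc n) W" using e(1,7) by (metis eq_refl induced_superset)
      moreover have "sphere_like (Suc n) (induced W (points W - {v}))" using h
        by (simp only: delete_points_def)
      ultimately have "points W - {v} = points W" by (rule sphere_like_rigid) simp
      then show False using e(2) by blast
    qed
    then obtain p where p: "p \<in> points W" "p \<notin> A" "p \<noteq> v" "(v, p) \<notin> adj W" by blast
    have "contractible (delete_points (delete_points W {v}) {p})"
      using p by (intro sphere_like_delete_point_contractible[OF h]) auto
    then have "contractible (delete_points (delete_points W A) {p})"
      using contr[OF p] by (simp add: dd insert_commute)
    then show "sphere_like (Suc n) (delete_points W A)"
      using h manifold_like p unfolding sphere_like_Suc_iff by auto
  next
    assume h: "sphere_like (Suc n) (delete_points W A)"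
    \<comment> \<open>On this side \<open>v\<close> belongs to the sphere, and a sphere is not a
      cone with apex \<open>v\<close>.\<close>
    obtain p where "p \<in> points (delete_points W A)" "p \<noteq> v" "(v, p) \<notin> adj (delete_points W A)"
      using sphere_like_not_cone[OF h, of v] e(2,4) by auto
    then have p: "p \<in> points W" "p \<notin> A" "p \<noteq> v" "(v, p) \<notin> adj W" using e(2,4) by auto
    have "contractible (delete_points (delete_points W A) {p})"
      using p by (intro sphere_like_delete_point_contractible[OF h]) auto
    then have "contractible (delete_points (delete_points W {v}) {p})"
      using contr[OF p] by (simp add: dd insert_commute)
    then show "sphere_like (Suc n) (delete_points W {v})"
      using h manifold_like p unfolding sphere_like_Suc_iff by auto
  qed
qed

lemmas exchange_manifold_like = exchange_manifold_like_aux[OF _ exchange_sphere_like]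

section \<open>Manifolds with boundary and gluing\<close>

text \<open>
  The added point lives in the option type because the points of \<open>N\<close> may exhaust their type.
\<close>

definition cone_off :: "'a graph \<Rightarrow> 'a set \<Rightarrow> 'a option graph" where
  "cone_off N B = add_point (map_graph Some N) None (Some ` B)"

lemma cone_off_simps [simp]:
  "points (cone_off N B) = insert None (Some ` points N)"
  "(Some x, Some y) \<in> adj (cone_off N B) \<longleftrightarrow> (x, y) \<in> adj N"
  "(None, Some y) \<in> adj (cone_off N B) \<longleftrightarrow> y \<in> B"
  "(Some y, None) \<in> adj (cone_off N B) \<longleftrightarrow> y \<in> B"
  "(None, None) \<notin> adj (cone_off N B)"
  by (auto simp: cone_off_def)

lemma nbrs_cone_off: "nbrs (cone_off N B) None = Some ` B"
proof (rule set_eqI)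
  fix x show "x \<in> nbrs (cone_off N B) None \<longleftrightarrow> x \<in> Some ` B" by (cases x) auto
qed

lemma cone_off_subset: "digital_space (cone_off N B) \<Longrightarrow> B \<subseteq> points N"
proof
  fix x assume "digital_space (cone_off N B)" "x \<in> B"
  then show "x \<in> points N" using digital_adjD(3)[of "cone_off N B" None "Some x"] by auto
qed

lemma digital_cone_off_iff: "digital_space (cone_off N B) \<longleftrightarrow> digital_space N \<and> B \<subseteq> points N"
proof safe
  assume d: "digital_space (cone_off N B)"
  show "digital_space N" unfolding digital_space_def
  proof (intro conjI)
    have "countable (Some ` points N)" using d by (simp add: digital_space_def)
    then show "countable (points N)" using countable_image_inj_on[of Some] by simp
    show "adj N \<subseteq> points N \<times> points N" using digital_adjD(2,3)[OF d, of "Some _" "Some _"] by auto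
    show "sym (adj N)" using digital_adjD(1)[OF d, of "Some _" "Some _"] by (auto intro: symI)
    show "irrefl (adj N)" using not_adj_self[OF d, of "Some _"] by (auto intro: irreflI)
  qed
next
  fix x assume "digital_space (cone_off N B)" "x \<in> B"
  then show "x \<in> points N" using cone_off_subset by blast
next
  assume "digital_space N" "B \<subseteq> points N"
  then show "digital_space (cone_off N B)"
    unfolding cone_off_def by (intro digital_add_point digital_map_graph) auto
qed

lemma delete_None_cone_off:
  "digital_space N \<Longrightarrow> delete_points (cone_off N B) {None} = map_graph Some N"
  by (rule graph_eqI) (auto simp: cone_off_def digital_space_def)

lemma cone_off_map_graph:
  assumes "digital_space N" "B \<subseteq> points N"
  shows "cone_off (map_graph e N) (e ` B) = map_graph (map_option e) (cone_off N B)"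
proof -
  have "map_graph ((map_option e)(None := None)) (add_point (map_graph Some N) None (Some ` B)) =
      add_point (map_graph (map_option e) (map_graph Some N)) None (map_option e ` Some ` B)"
    using assms by (intro map_graph_add_point digital_map_graph) auto
  moreover have "(map_option e)(None := None) = map_option e" by auto
  ultimately show ?thesis
    by (simp add: cone_off_def map_graph_comp image_image comp_def)
qed

lemma sphere_like_map_Some:
  "sphere_like n (map_graph Some (G :: 'a::infinite graph)) \<longleftrightarrow> sphere_like n G"
proof
  assume h: "sphere_like n (map_graph Some G)"
  have "the \<circ> Some = (id :: 'a \<Rightarrow> 'a)" by auto
  then have "map_graph the (map_graph Some G) = G"
    unfolding map_graph_comp by (simp add: map_graph_def prod.map_id0)
  then show "sphere_like n G"
    using sphere_like_map_graph[OF digital_sphere_like[OF h], of the n] h by (auto simp: inj_on_def)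
qed (simp add: sphere_like_map_graph digital_sphere_like)

text \<open>The closed manifold in the definition of a manifold with boundary is determined up to
  isomorphism by what remains and by its boundary: \<open>v\<close> turns into \<open>None\<close>
  and every other point follows \<open>f\<close>.\<close>

lemma cone_off_delete_point:
  assumes "digital_space M" "v \<in> points M" "inj_on f (points M - {v})"
  defines "e \<equiv> \<lambda>x. if x = v then None else Some (f x)"
  shows "map_graph e M = cone_off (map_graph f (delete_points M {v})) (f ` nbrs M v)"
    "inj_on e (points M)"
proof -
  let ?D = "delete_points M {v}"
  have n: "nbrs M v \<subseteq> points ?D" using assms(1) nbrs_subset[OF assms(1), of v] by auto
  have "add_point ?D v (nbrs M v) = M"
    using digital_adjD[OF assms(1)] assms(2) by (intro graph_eqI) auto
  then have "map_graph e M = map_graph ((Some \<circ> f)(v := None)) (add_point ?D v (nbrs M v))"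
    by (auto simp: e_def intro!: arg_cong2[of _ _ _ _ map_graph])
  also have "\<dots> = add_point (map_graph (Some \<circ> f) ?D) None ((Some \<circ> f) ` nbrs M v)"
    using assms(1) n by (intro map_graph_add_point) auto
  finally show "map_graph e M = cone_off (map_graph f ?D) (f ` nbrs M v)"
    by (simp add: cone_off_def map_graph_comp image_comp)
  show "inj_on e (points M)"
    using assms(3) by (auto simp: e_def inj_on_def)
qed

text \<open>The index is shifted as in \<open>manifold_like\<close>: \<open>disk_like n\<close>
  stands for disks of dimension \<open>Suc n\<close>, since closing off preserves the
  dimension.\<close>

definition disk_like :: "nat \<Rightarrow> 'a::infinite graph \<Rightarrow> 'a set \<Rightarrow> bool" where
  "disk_like n D B \<longleftrightarrow> sphere_like (Suc n) (cone_off D B)"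

lemma disk_like_digital: "disk_like n D B \<Longrightarrow> digital_space D \<and> B \<subseteq> points D"
  unfolding disk_like_def using digital_sphere_like digital_cone_off_iff by metis

text \<open>In a sphere every point has a contractible complement, in particular
  \<open>None\<close>, whose complement is a copy of \<open>D\<close>.\<close>

lemma disk_like_iff: "disk_like n D B \<longleftrightarrow> manifold_like n (cone_off D B) \<and> contractible D"
proof -
  have *: "contractible (delete_points (cone_off D B) {None}) \<longleftrightarrow> contractible D"
    if "manifold_like n (cone_off D B)"
  proof -
    have "digital_space D" using that unfolding manifold_like_def by (auto
      simp: digital_cone_off_iff)
    then show ?thesis by (simp add: delete_None_cone_off contractible_map_graph)
  qed
  show ?thesis
  proof
    assume h: "disk_like n D B"
    then have "manifold_like n (cone_off D B)" unfolding disk_like_def sphere_like_Suc_iff by blast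
    then show "manifold_like n (cone_off D B) \<and> contractible D"
      using * sphere_like_delete_point_contractible[of "Suc n" "cone_off D B" None] h
      by (simp add: disk_like_def del: sphere_like.simps)
  next
    assume "manifold_like n (cone_off D B) \<and> contractible D"
    then show "disk_like n D B"
      using * unfolding disk_like_def sphere_like_Suc_iff by auto
  qed
qed

lemma disk_like_map_graph:
  assumes "disk_like n D B" "inj_on e (points D)"
  shows "disk_like n (map_graph e D) (e ` B)"
proof -
  have d: "digital_space D" "B \<subseteq> points D" using disk_like_digital[OF assms(1)] by auto
  moreover from this have "digital_space (cone_off D B)" by (simp add: digital_cone_off_iff)
  moreover have "inj_on (map_option e) (points (cone_off D B))"
    using assms(2) by (auto simp: inj_on_def)
  ultimately show ?thesis
    using assms(1) sphere_like_map_graph unfolding disk_like_def by (metis cone_off_map_graph)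
qed

text \<open>In the glued graph \<open>v\<close> and the interior of \<open>D\<close> coexist. The
  disk closed up by \<open>v\<close> is the image of \<open>cone_off D B\<close>, with
  \<open>None\<close> sent to \<open>v\<close> and the boundary sent along \<open>f\<close>.\<close>

lemma glue_exchange:
  fixes N D :: "'a::infinite graph"
  assumes N: "digital_space N" "v \<in> points N" and D: "disk_like n D B"
    and disj: "points D \<inter> points N = {}" and f: "isomorphism f (induced D B) (rim N v)"
  shows "exchange (Suc n) (glue N D B f) v (points D - B)"
    and "delete_points (glue N D B f) (points D - B) = N"
proof -
  let ?W = "glue N D B f" and ?A = "points D - B"
  define g where "g = (\<lambda>x. if x \<in> B then f x else x)"
  have W: "points ?W = points N \<union> g ` points D" "adj ?W = adj N \<union> map_prod g g ` adj D"
    by (simp_all add: glue_def g_def Let_def)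
  have dD: "digital_space D" and BD: "B \<subseteq> points D" using disk_like_digital[OF D] by auto
  note DD = digital_adjD[OF dD]
  note NN = digital_adjD[OF N(1)]
  have fi: "inj_on f B" using f BD by (auto simp: isomorphism_iff Int_absorb1)
  have rim: "rim N v = map_graph f (induced D B)" using f by (simp add: isomorphism_iff)
  have fB: "f ` B = nbrs N v"
    using arg_cong[OF rim, of points] nbrs_subset[OF N(1), of v] BD by (simp add: Int_absorb1)
  have fadj: "adj N \<inter> nbrs N v \<times> nbrs N v = map_prod f f ` (adj D \<inter> B \<times> B)"
    using arg_cong[OF rim, of adj] by (simp add: rim_def)
  have gB: "g x = f x" if "x \<in> B" for x using that by (simp add: g_def)
  have gA: "g x = x" if "x \<notin> B" for x using that by (simp add: g_def)
  have gN: "g x \<in> nbrs N v \<and> g x \<in> points N" if "x \<in> B" for x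
    using that gB[OF that] fB nbrs_subset[OF N(1), of v] by blast
  have gNA: "g x \<in> ?A \<and> g x \<notin> points N" if "x \<in> points D" "x \<notin> B" for x
    using that disj gA by auto
  have gi: "inj_on g (points D)"
  proof (rule inj_onI)
    fix x y assume "x \<in> points D" "y \<in> points D" "g x = g y"
    then show "x = y"
      using gN gNA gA gB fi by (metis inj_onD)
  qed
  have vD: "v \<notin> g ` points D"
    using gN gNA N not_adj_self[OF N(1), of v] by (metis imageE nbrs_iff)
  have dW: "digital_space ?W" unfolding digital_space_def
  proof (intro conjI)
    show "countable (points ?W)" using N(1) dD by (simp add: W digital_space_def)
    show "adj ?W \<subseteq> points ?W \<times> points ?W" using NN(2,3) DD(2,3) by (auto simp: W)
    show "sym (adj ?W)"
    proof (rule symI)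
      fix x y assume "(x, y) \<in> adj ?W"
      then consider "(x, y) \<in> adj N" | p q where "(p, q) \<in> adj D" "x = g p" "y = g q"
        by (auto simp: W)
      then show "(y, x) \<in> adj ?W"
        by cases (use NN(1) DD(1) in \<open>force simp: W\<close>)+
    qed
    show "irrefl (adj ?W)"
    proof (rule irreflI)
      fix x
      have "g a \<noteq> g b" if "(a, b) \<in> adj D" for a b
        using inj_onD[OF gi, of a b] DD(2-4)[OF that] by blast
      then show "(x, x) \<notin> adj ?W" using N(1) by (auto simp: W)
    qed
  qed
  have nv: "nbrs ?W v = nbrs N v"
    using vD DD(2,3) by (auto simp: W)
  have na: "nbrs ?W a \<subseteq> ?A \<union> nbrs ?W v" if a: "a \<in> ?A" for a
  proof
    fix y assume "y \<in> nbrs ?W a"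
    then have "(a, y) \<in> adj ?W" by simp
    moreover have "(a, y) \<notin> adj N" using a disj NN(2) by auto
    ultimately obtain p q where "(p, q) \<in> adj D" "y = g q" by (auto simp: W)
    then show "y \<in> ?A \<union> nbrs ?W v"
      unfolding nv using DD(3) gN gNA by blast
  qed
  have gD: "g ` points D = ?A \<union> nbrs N v"
  proof -
    have "g ` points D = g ` ?A \<union> g ` B" using BD by blast
    moreover have "g ` ?A = ?A" using gA by force
    moreover have "g ` B = f ` B" using gB by (intro image_cong) auto
    ultimately show ?thesis using fB by simp
  qed
  let ?K = "induced ?W (insert v (?A \<union> nbrs ?W v))"
  let ?k = "case_option v g"
  have "map_graph ?k (cone_off D B) = ?K"
  proof (rule graph_eqI)
    have "points ?K = insert v (?A \<union> nbrs N v)"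
      using nbrs_subset[OF N(1), of v] N(2) gD by (auto simp: nv W)
    also have "\<dots> = ?k ` points (cone_off D B)"
      using gD by (auto simp: image_image)
    finally show "points (map_graph ?k (cone_off D B)) = points ?K" by simp
    have "adj (map_graph ?k (cone_off D B)) = map_prod g g ` adj D \<union> {v} \<times> nbrs N v \<union> nbrs N v \<times> {v}"
    proof -
      have "?k ` Some ` B = nbrs N v" using gB fB by (auto simp: image_image)
      then show ?thesis
        by (simp add: cone_off_def image_Un map_prod_surj_on[OF refl refl] image_comp
            prod.map_comp comp_def del: image_image)
    qed
    also have "\<dots> = adj ?K"
    proof (intro equalityI subsetI)
      fix p assume "p \<in> map_prod g g ` adj D \<union> {v} \<times> nbrs N v \<union> nbrs N v \<times> {v}"
      then consider "p \<in> map_prod g g ` adj D" | "p \<in> {v} \<times> nbrs N v \<union> nbrs N v \<times> {v}" by blast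
      then show "p \<in> adj ?K"
      proof cases
        case 1
        then obtain x y where "(x, y) \<in> adj D" "p = (g x, g y)" by auto
        then have "p \<in> g ` points D \<times> g ` points D" using DD(2,3) by auto
        then have "p \<in> insert v (?A \<union> nbrs ?W v) \<times> insert v (?A \<union> nbrs ?W v)"
          unfolding gD nv by blast
        then show ?thesis using 1 by (simp add: W)
      next
        case 2
        then show ?thesis using NN(1) by (auto simp: W)
      qed
    next
      fix p assume p: "p \<in> adj ?K"
      obtain x y where "p = (x, y)" by (cases p)
      moreover from this have "x \<in> insert v (?A \<union> nbrs N v)" "y \<in> insert v (?A \<union> nbrs N v)"
        using p unfolding nv adj_induced by blast+
      moreover have "p \<in> adj N \<or> p \<in> map_prod g g ` adj D" using p by (simp add: W)
      ultimately have xy: "p = (x, y)" "x \<in> insert v (?A \<union> nbrs N v)"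
        "y \<in> insert v (?A \<union> nbrs N v)" "p \<in> adj N \<or> p \<in> map_prod g g ` adj D" by blast+
      show "p \<in> map_prod g g ` adj D \<union> {v} \<times> nbrs N v \<union> nbrs N v \<times> {v}"
      proof (cases "p \<in> adj N")
        case True
        then have "x \<in> insert v (nbrs N v)" "y \<in> insert v (nbrs N v)"
          using xy disj NN(2,3) by blast+
        \<comment> \<open>An edge of \<open>N\<close> inside the rim of \<open>v\<close> is the
          image of an edge of \<open>D\<close>, because \<open>f\<close> is an isomorphism of
          induced subgraphs.\<close>
        then consider "x = v" | "y = v" | "p \<in> adj N \<inter> nbrs N v \<times> nbrs N v" using True xy(1) by auto
        then show ?thesis
        proof cases
          case 3
          then obtain a b where "(a, b) \<in> adj D" "a \<in> B" "b \<in> B" "p = (f a, f b)"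
            unfolding fadj by auto
          then show ?thesis using gB[of a] gB[of b] by force
        qed (use True xy(1) NN(1) in auto)
      qed (use xy in blast)
    qed
    finally show "adj (map_graph ?k (cone_off D B)) = adj ?K" .
  qed
  moreover have "inj_on ?k (points (cone_off D B))"
    using gi vD by (auto simp: inj_on_def image_iff)
  ultimately have "sphere_like (Suc n) ?K"
    using D sphere_like_map_graph unfolding disk_like_def by (metis digital_sphere_like)
  moreover have "v \<notin> ?A" "?A \<inter> nbrs ?W v = {}" "?A \<subseteq> points ?W"
    using N(2) disj nbrs_subset[OF N(1), of v] gD unfolding nv W by auto
  ultimately show "exchange (Suc n) ?W v ?A"
    unfolding exchange_def using dW N(2) na by (simp add: W(1) del: sphere_like.simps)
  show "delete_points ?W ?A = N"
  proof (rule graph_eqI)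
    show "points (delete_points ?W ?A) = points N"
      using disj nbrs_subset[OF N(1), of v] gD by (auto simp: W)
    then have "adj (delete_points ?W ?A) = adj ?W \<inter> points N \<times> points N" by simp
    also have "\<dots> = adj N"
    proof (intro equalityI subsetI)
      fix p assume p: "p \<in> adj ?W \<inter> points N \<times> points N"
      show "p \<in> adj N"
      proof (cases "p \<in> adj N")
        case False
        \<comment> \<open>An edge from \<open>D\<close> with both ends in \<open>N\<close> joins
          images of boundary points, so the isomorphism \<open>f\<close> makes it an edge of
          \<open>N\<close> already.\<close>
        then obtain a b where ab: "(a, b) \<in> adj D" "p = (g a, g b)" using p by (auto simp: W)
        then have "a \<in> B" "b \<in> B" using gNA p DD(2,3) by blast+
        then have "p \<in> map_prod f f ` (adj D \<inter> B \<times> B)" using ab gB by force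
        then show ?thesis unfolding fadj[symmetric] by blast
      qed
    qed (use NN(2,3) in \<open>auto simp: W\<close>)
    finally show "adj (delete_points ?W ?A) = adj N" .
  qed
qed

text \<open>Spheres of dimension 1 are defined by their rims and not by gluing disks, so their
  contractible complements are found directly, by growing a path along the cycle.\<close>

lemma finite_cycle_delete_point_contractible:
  fixes G :: "'a::infinite graph"
  assumes G: "digital_space G" "finite (points G)" "connected_graph G"
    and two: "\<And>x. x \<in> points G \<Longrightarrow> sphere_like 0 (rim G x)"
  shows "\<exists>v \<in> points G. contractible (delete_points G {v})"
proof -
  note GG = digital_adjD[OF G(1)]
  have nb: "\<exists>p q. p \<noteq> q \<and> nbrs G x = {p, q}" if x: "x \<in> points G" for x
  proof -
    obtain p q where "p \<noteq> q" "rim G x = \<lparr>points = {p, q}, adj = {}\<rparr>" using two[OF x] by auto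
    then have "p \<noteq> q" "points (rim G x) = {p, q}" by simp_all
    then show ?thesis using nbrs_subset[OF G(1), of x] by (auto simp: Int_absorb1)
  qed
  \<comment> \<open>Proper subpaths with at least two points and with ends \<open>a\<close>, \<open>b\<close>: a maximal one omits a single point.\<close>
  define P where "P S \<longleftrightarrow> S \<subseteq> points G \<and> S \<noteq> points G \<and> contractible (induced G S) \<and>
    (\<exists>a \<in> S. \<exists>b \<in> S. (\<forall>c \<in> S - {a, b}. nbrs G c \<subseteq> S) \<and> nbrs G a \<inter> S \<noteq> {} \<and> nbrs G b \<inter> S \<noteq> {})" for S
  have "\<exists>S. P S"
  proof -
    obtain a where a: "a \<in> points G" using connected_graph_nonempty[OF G(3)] by blast
    obtain p q where pq: "p \<noteq> q" "nbrs G a = {p, q}" using nb[OF a] by blast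
    then have ap: "(a, p) \<in> adj G" "(a, q) \<in> adj G" by (simp_all flip: nbrs_iff)
    note ap' = GG[OF ap(1)] and aq' = GG[OF ap(2)]
    have "contractible (induced G {a, p})"
      using ap ap' G(1) by (intro contractible_cone[where v = a]) auto
    moreover have "q \<notin> {a, p}" using pq aq' by auto
    ultimately have "P {a, p}"
      unfolding P_def using ap ap' aq' by (intro conjI bexI[of _ a] bexI[of _ p]) auto
    then show ?thesis by blast
  qed
  moreover have "finite {S. P S}"
    by (rule finite_subset[of _ "Pow (points G)"]) (use G(2) in \<open>auto simp: P_def\<close>)
  ultimately obtain S where S: "P S" and max: "\<And>T. P T \<Longrightarrow> S \<subseteq> T \<Longrightarrow> S = T"
    using finite_has_maximal[of "{S. P S}"] by auto
  have Ssub: "S \<subseteq> points G" "S \<noteq> points G" and Sc: "contractible (induced G S)"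
    using S by (auto simp: P_def)
  obtain a0 b0 where ab0: "a0 \<in> S" "b0 \<in> S" "\<And>c. c \<in> S \<Longrightarrow> c \<noteq> a0 \<Longrightarrow> c \<noteq> b0 \<Longrightarrow> nbrs G c \<subseteq> S"
    "nbrs G a0 \<inter> S \<noteq> {}" "nbrs G b0 \<inter> S \<noteq> {}"
    using S unfolding P_def by blast
  obtain c x where cx: "c \<in> S" "(c, x) \<in> adj G" "x \<notin> S"
    using connected_graphD[OF G(3,1) Ssub(1)] ab0(1) Ssub(2) by blast
  then have "c = a0 \<or> c = b0" using ab0(3)[of c] by (metis nbrs_iff subsetD)
  then obtain a b where ab: "a \<in> S" "b \<in> S" "\<And>c. c \<in> S \<Longrightarrow> c \<noteq> a \<Longrightarrow> c \<noteq> b \<Longrightarrow> nbrs G c \<subseteq> S"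
    "nbrs G a \<inter> S \<noteq> {}" "nbrs G b \<inter> S \<noteq> {}" and ax: "(a, x) \<in> adj G"
    using ab0 cx(2) by metis
  note ax' = GG[OF ax]
  \<comment> \<open>An end of the path has only two neighbours; one is already in \<open>S\<close>,
    so \<open>x\<close> is the other.\<close>
  have end_nbrs: "nbrs G z \<subseteq> insert x S" if zx: "(z, x) \<in> adj G" and zS: "nbrs G z \<inter> S \<noteq> {}" for z
  proof -
    obtain p q where "nbrs G z = {p, q}" using nb[OF GG(2)[OF zx]] by blast
    moreover have "x \<in> nbrs G z" using zx by simp
    ultimately show ?thesis using zS cx(3)
      by (metis Int_emptyI empty_subsetI insert_iff insert_subset singletonD)
  qed
  let ?T = "insert x S"
  have T: "?T \<subseteq> points G" using Ssub ax' by auto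
  have "?T = points G"
  \<comment> \<open>If \<open>x\<close> meets both ends, it closes the cycle and nothing is left
    outside. Otherwise \<open>x\<close> is a new end, and maximality of \<open>S\<close> leaves no
    room for a longer proper path.\<close>
  proof (cases "(b, x) \<in> adj G \<and> a \<noteq> b")
    case True
    obtain p q where "nbrs G x = {p, q}" using nb ax'(3) by blast
    moreover have "a \<in> nbrs G x" "b \<in> nbrs G x" using ax' GG(1)[of b x] True by auto
    ultimately have nx: "nbrs G x = {a, b}" using True by (metis insertE insert_commute singletonD)
    show ?thesis
    proof (rule connected_graphD[OF G(3,1) T])
      fix y z assume y: "y \<in> ?T" and "(y, z) \<in> adj G"
      then have z: "z \<in> nbrs G y" by simp
      consider "y = x" | "y = a" | "y = b" | "y \<in> S" "y \<noteq> a" "y \<noteq> b" using y by blast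
      then have "nbrs G y \<subseteq> ?T"
      proof cases
        case 1
        then show ?thesis using nx ab(1,2) by simp
      next
        case 2
        then show ?thesis using end_nbrs[OF ax ab(4)] by metis
      next
        case 3
        then show ?thesis using end_nbrs[of b] ab(5) True by metis
      next
        case 4
        then show ?thesis using ab(3)[of y] by blast
      qed
      then show "z \<in> ?T" using z by (rule subsetD)
    qed simp
  next
    case False
    have nx: "nbrs G x \<inter> S = {a}"
    proof (intro equalityI subsetI)
      fix c assume c: "c \<in> nbrs G x \<inter> S"
      then have "(c, x) \<in> adj G" using GG(1) by auto
      then show "c \<in> {a}" using False ab(3)[of c] c cx(3)
        by (metis IntD2 nbrs_iff singletonI subsetD)
    qed (use ax' ab in auto)
    have "contractible (induced G ?T)"
    proof -
      have "rim (induced G ?T) x = one_point a"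
      proof -
        have "?T \<inter> nbrs G x = {a}" using nx not_adj_self[OF G(1), of x] by auto
        then have "rim (induced G ?T) x = induced G {a}" by (simp add: rim_induced)
        then show ?thesis using ax'(2) G(1) by (intro graph_eqI) auto
      qed
      moreover have "delete_points (induced G ?T) {x} = induced G S"
        using cx(3) GG(2,3) by (intro graph_eqI) auto
      ultimately show ?thesis
        using contractible_delete_point_iff[of "induced G ?T" x] ax'(3) Sc G(1)
        by (simp add: one_point)
    qed
    moreover have "\<forall>c \<in> ?T - {x, b}. nbrs G c \<subseteq> ?T"
      using end_nbrs[OF ax ab(4)] ab(3) by (metis DiffE insertE insertI1 insertI2 subset_insertI2)
    moreover have "nbrs G x \<inter> ?T \<noteq> {}" "nbrs G b \<inter> ?T \<noteq> {}" using nx ab(5) by blast+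
    ultimately have "P ?T" if "?T \<noteq> points G"
      unfolding P_def using that T ab(2) by blast
    then show ?thesis using max[of ?T] cx(3) by blast
  qed
  moreover have "delete_points G {x} = induced G (points G - {x})" by (simp add: delete_points_def)
  ultimately have "delete_points G {x} = induced G S" using cx(3) by (metis Diff_insert_absorb)
  then show ?thesis using Sc ax'(3) by metis
qed

text \<open>Glue \<open>C\<close> onto the rim of \<open>None\<close> in the sphere
  \<open>cone_off D BD\<close>. Deleting the interior of \<open>C\<close> gives back this sphere,
  deleting \<open>None\<close> gives a copy of the glued disks, and an exchange relates the
  two.\<close>

lemma sphere_like_glue:
  fixes D C :: "'a::infinite graph"
  assumes D: "disk_like n D BD" and C: "disk_like n C BC" and disj: "points D \<inter> points C = {}"
    and f: "isomorphism f (induced C BC) (induced D BD)"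
  shows "sphere_like (Suc n) (glue D C BC f)"
proof -
  let ?N = "cone_off D BD" and ?C = "map_graph Some C" and ?f = "map_option f"
  let ?W = "glue ?N ?C (Some ` BC) ?f"
  have dD: "digital_space D" "BD \<subseteq> points D" using disk_like_digital[OF D] by auto
  have dC: "digital_space C" "BC \<subseteq> points C" using disk_like_digital[OF C] by auto
  have dN: "digital_space ?N" using dD by (simp add: digital_cone_off_iff)
  have C': "disk_like n ?C (Some ` BC)" by (intro disk_like_map_graph C) simp
  have "rim ?N None = map_graph Some (induced D BD)"
  proof -
    have "rim ?N None = induced (delete_points ?N {None}) (Some ` BD)"
      unfolding rim_def nbrs_cone_off using digital_adjD(2,3)[OF dD(1)] by (intro graph_eqI) auto
    then show ?thesis using dD by (simp add: delete_None_cone_off map_graph_induced)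
  qed
  moreover have "map_graph ?f (induced ?C (Some ` BC)) = map_graph Some (induced D BD)"
  proof -
    have "map_graph ?f (map_graph Some (induced C BC)) = map_graph Some (map_graph f (induced C BC))"
      by (simp add: map_graph_comp comp_def)
    then show ?thesis using dC f by (simp add: map_graph_induced isomorphism_iff)
  qed
  moreover have "inj_on ?f (points (induced ?C (Some ` BC)))"
    using f dC(2) by (auto simp: isomorphism_iff inj_on_def)
  ultimately have iso: "isomorphism ?f (induced ?C (Some ` BC)) (rim ?N None)"
    unfolding isomorphism_iff by simp
  have "points ?C \<inter> points ?N = {}" using disj by auto
  note g = glue_exchange[OF dN _ C' this iso]
  have "sphere_like (Suc n) (delete_points ?W {None})"
    using exchange_sphere_like[OF g(1)] g(2) D by (simp add: disk_like_def del: sphere_like.simps)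
  moreover have "delete_points ?W {None} = map_graph Some (glue D C BC f)"
  proof -
    define g where "g = (\<lambda>x. if x \<in> BC then f x else x)"
    have g': "(if Some x \<in> Some ` BC then ?f (Some x) else Some x) = Some (g x)" for x
      by (auto simp: g_def)
    let ?g = "\<lambda>x. if x \<in> Some ` BC then ?f x else x"
    have "?g ` points ?C = Some ` g ` points C"
      unfolding map_graph_simps image_image by (intro image_cong refl g')
    moreover have "map_prod ?g ?g ` adj ?C = map_prod Some Some ` map_prod g g ` adj C"
      by (simp add: image_comp prod.map_comp comp_def g')
    ultimately have W: "points ?W = points ?N \<union> Some ` g ` points C"
      "adj ?W = adj ?N \<union> map_prod Some Some ` map_prod g g ` adj C"
      by (simp_all add: glue_def Let_def)
    have N: "points ?N = insert None (Some ` points D)"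
      "adj ?N = map_prod Some Some ` adj D \<union> {None} \<times> Some ` BD \<union> Some ` BD \<times> {None}"
      by (simp_all add: cone_off_def)
    have "points (glue D C BC f) = points D \<union> g ` points C"
      "adj (glue D C BC f) = adj D \<union> map_prod g g ` adj C"
      by (simp_all add: glue_def Let_def g_def)
    then show ?thesis
      using digital_adjD(2,3)[OF dD(1)] digital_adjD(2,3)[OF dC(1)]
      by (intro graph_eqI) (auto simp: W N)
  qed
  ultimately show ?thesis by (simp only: sphere_like_map_Some)
qed

text \<open>The four predicates are mutually inductive, so the translations are proved together.
  Glued disks are covered by an exchange, 1-spheres by the contractible path left after deleting a
  point, and boundaries by closing them off.\<close>

lemma sphere_imp_sphere_like:
  fixes G :: "'a::infinite graph"
  shows "sphere n G \<Longrightarrow> sphere_like n G"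
    "closed_manifold n G \<Longrightarrow> \<exists>m. n = Suc m \<and> manifold_like m G"
    "manifold_with_boundary n G B \<Longrightarrow> \<exists>m. n = Suc m \<and> connected_graph G \<and> manifold_like m (cone_off G B)"
    "disk n G B \<Longrightarrow> \<exists>m. n = Suc m \<and> connected_graph G \<and> disk_like m G B"
proof (induction rule: sphere_closed_manifold_manifold_with_boundary_disk.inducts)
  case (sphere_0 a b)
  then show ?case by auto
next
  case (sphere_1 G)
  then have "\<exists>v \<in> points G. contractible (delete_points G {v})"
    by (intro finite_cycle_delete_point_contractible) blast+
  then show ?case using sphere_1 by simp
next
  case (sphere_n n D BD C BC f h G)
  then obtain m where m: "n = Suc m" "disk_like m D BD" "disk_like m C BC" by auto
  then have "sphere_like n (glue D C BC f)" using sphere_n sphere_like_glue by blast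
  then show ?case using sphere_n.hyps sphere_like_map_graph digital_sphere_like
    unfolding isomorphism_iff by metis
next
  case (closed_manifold M n)
  then show ?case by (simp add: manifold_like_def)
next
  case (manifold_with_boundary n M v f N)
  then obtain m where m: "n = Suc m" "manifold_like m M" by auto
  have f: "inj_on f (points M - {v})" "N = map_graph f (delete_points M {v})"
    using manifold_with_boundary.hyps by (auto simp: isomorphism_iff)
  have "digital_space M" using m(2) by (simp add: manifold_like_def)
  note c = cone_off_delete_point[OF this manifold_with_boundary.hyps(2) f(1)]
  have "manifold_like m (cone_off N (f ` nbrs M v))"
    using c manifold_like_map_graph m(2) f(2) by (metis \<open>digital_space M\<close>)
  then show ?case using m(1) manifold_with_boundary.hyps by blast
next
  case (disk n D B)
  then show ?case by (auto simp: disk_like_iff)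
qed

section \<open>From point complements back to disks\<close>

lemma sphere_like_suspension_aux:
  fixes H :: "'a::infinite graph"
  assumes "digital_space H" "a \<noteq> b" "points H = insert a (insert b T)" "nbrs H a = T" "nbrs H b = T"
    "sphere_like n (induced H T)" and rims: "\<And>x. x \<in> T \<Longrightarrow> sphere_like n (rim H x)"
  shows "sphere_like (Suc n) H"
proof -
  have T: "points (induced H T) = T" using assms(3) by auto
  have T_iff: "(a, x) \<in> adj H \<longleftrightarrow> x \<in> T" "(b, x) \<in> adj H \<longleftrightarrow> x \<in> T" for x
    using assms(4,5) by (simp_all add: set_eq_iff)
  have ne: "T \<noteq> {}" using sphere_like_nonempty[OF assms(6)] T by simp
  have "rim H a = induced H T" "rim H b = induced H T" using assms(4,5) by (simp_all add: rim_def)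
  then have "\<forall>x \<in> points H. sphere_like n (rim H x)" using rims assms(3,6) by auto
  moreover have "connected_graph H"
  proof (rule connected_graphI[OF assms(1)])
    show "points H \<noteq> {}" using assms(3) by simp
    fix S assume S: "S \<subseteq> points H" "S \<noteq> {}" "\<And>x y. x \<in> S \<Longrightarrow> (x, y) \<in> adj H \<Longrightarrow> y \<in> S"
    have 1: "T \<subseteq> S" if "a \<in> S \<or> b \<in> S" using that S(3)[of a] S(3)[of b] T_iff by blast
    have 2: "a \<in> S \<and> b \<in> S" if "x \<in> S" "x \<in> T" for x
      using S(3)[of x] that T_iff digital_adjD(1)[OF assms(1)] by blast
    obtain z where "z \<in> S" using S(2) by blast
    then have "a \<in> S \<or> b \<in> S" using S(1) 2[of z] assms(3) by auto
    then have "T \<subseteq> S" by (rule 1)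
    moreover from this have "a \<in> S \<and> b \<in> S" using 2 ne by blast
    ultimately show "points H \<subseteq> S" using assms(3) by simp
  qed
  moreover have "contractible (delete_points H {a})"
  proof (rule contractible_cone[where v = b])
    show "finite (points (delete_points H {a}))" using finite_sphere_like[OF assms(6)] T assms(3)
      by simp
    fix x assume "x \<in> points (delete_points H {a})" "x \<noteq> b"
    then show "(b, x) \<in> adj (delete_points H {a})" using assms(2,3) T_iff by auto
  qed (use assms in auto)
  ultimately show ?thesis unfolding sphere_like.simps using assms(1,3) by blast
qed

text \<open>The rim of a point \<open>x\<close> of \<open>T\<close> is the suspension of the rim of
  \<open>x\<close> within \<open>T\<close>; in dimension 0 it is just the pair of apexes. The result
  is used to recognise the cone over a rim as a disk.\<close>

lemma sphere_like_suspension: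
  fixes H :: "'a::infinite graph"
  assumes "digital_space H" "a \<noteq> b" "points H = insert a (insert b T)" "nbrs H a = T" "nbrs H b = T"
    "sphere_like n (induced H T)"
  shows "sphere_like (Suc n) H"
  using assms
proof (induction n arbitrary: H T)
  case (0 H T)
  note HH = digital_adjD[OF 0(1)]
  have T_iff: "(a, x) \<in> adj H \<longleftrightarrow> x \<in> T" "(b, x) \<in> adj H \<longleftrightarrow> x \<in> T" for x
    using 0(4,5) by (simp_all add: set_eq_iff)
  have ab: "a \<notin> T" "b \<notin> T" using T_iff 0(1) by (metis not_adj_self)+
  show ?case
  proof (rule sphere_like_suspension_aux[OF 0])
    fix x assume x: "x \<in> T"
    have "adj H \<inter> T \<times> T = {}" using 0(6) unfolding sphere_like_0_iff by simp
    then have "y \<in> {a, b}" if "(x, y) \<in> adj H" for y using that x HH(3)[OF that] 0(3) by blast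
    moreover have "(x, a) \<in> adj H" "(x, b) \<in> adj H" using x T_iff HH(1) by blast+
    ultimately have "nbrs H x = {a, b}" unfolding nbrs_def by blast
    moreover have "adj H \<inter> {a, b} \<times> {a, b} = {}" using T_iff ab by auto
    ultimately have "rim H x = \<lparr>points = {a, b}, adj = {}\<rparr>"
      using 0(3) by (intro graph_eqI) (auto simp: rim_def)
    then show "sphere_like 0 (rim H x)" using 0(2) by auto
  qed
next
  case (Suc n H T)
  note HH = digital_adjD[OF Suc.prems(1)]
  have T_iff: "(a, x) \<in> adj H \<longleftrightarrow> x \<in> T" "(b, x) \<in> adj H \<longleftrightarrow> x \<in> T" for x
    using Suc.prems(4,5) by (simp_all add: set_eq_iff)
  show ?case
  proof (rule sphere_like_suspension_aux[OF Suc.prems])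
    fix x assume x: "x \<in> T"
    then have xa: "(x, a) \<in> adj H" "(x, b) \<in> adj H" using T_iff HH(1) by blast+
    have xH: "x \<in> points H" using HH(2)[OF xa(1)] .
    show "sphere_like (Suc n) (rim H x)"
    proof (rule Suc.IH)
      show "points (rim H x) = insert a (insert b (T \<inter> nbrs H x))"
        using Suc.prems(3) xa HH(3,4) by auto
      show "nbrs (rim H x) a = T \<inter> nbrs H x" "nbrs (rim H x) b = T \<inter> nbrs H x"
        using nbrs_rim[OF xa(1)] nbrs_rim[OF xa(2)] Suc.prems(4,5) by auto
      have "induced (rim H x) (T \<inter> nbrs H x) = rim (induced H T) x"
        unfolding rim_induced[OF x] by (simp add: rim_def Int_ac)
      moreover have "sphere_like n (rim (induced H T) x)" using Suc.prems(6) x xH by simp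
      ultimately show "sphere_like n (induced (rim H x) (T \<inter> nbrs H x))" by simp
    qed (use Suc.prems in auto)
  qed
qed

lemma manifold_like_imp_closed_manifold:
  assumes "\<And>G :: 'a::infinite graph. sphere_like n G \<Longrightarrow> sphere n G" "manifold_like n (M :: 'a graph)"
  shows "closed_manifold (Suc n) M"
  using assms by (auto simp: manifold_like_def intro: closed_manifold)

text \<open>The definition asks for a closed manifold in the point type of \<open>N\<close>, while
  \<open>cone_off N B\<close> lives in the option type. Its countably many points are therefore all
  copied back into \<open>'a\<close>. The translation of spheres is an assumption because it is
  still under induction.\<close>

lemma manifold_like_imp_manifold_with_boundary:
  assumes IH: "\<And>G :: 'a::infinite graph. sphere_like n G \<Longrightarrow> sphere n G"
    and N: "connected_graph N" "manifold_like n (cone_off (N :: 'a graph) B)"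
  shows "manifold_with_boundary (Suc n) N B"
proof -
  let ?P = "points (cone_off N B)"
  have dC: "digital_space (cone_off N B)" using N(2) by (simp add: manifold_like_def)
  then have dN: "digital_space N" "B \<subseteq> points N" by (auto simp: digital_cone_off_iff)
  obtain j :: "nat \<Rightarrow> 'a" where j: "inj j"
    using infinite_countable_subset[OF infinite_UNIV] by blast
  have "countable ?P" using dC unfolding digital_space_def by blast
  define e where "e = j \<circ> to_nat_on ?P"
  have e: "inj_on e ?P"
    unfolding e_def
    by (rule comp_inj_on[OF inj_on_to_nat_on[OF \<open>countable ?P\<close>] inj_on_subset[OF j subset_UNIV]])
  \<comment> \<open>\<open>k\<close> undoes the copying and strips \<open>Some\<close>, so that
    deleting the added point yields \<open>N\<close> under its own names.\<close>
  define k where "k = the \<circ> inv_into ?P e"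
  have k: "k (e (Some x)) = x" if "x \<in> points N" for x
    using that e by (simp add: k_def)
  let ?M = "map_graph e (cone_off N B)"
  have "closed_manifold (Suc n) ?M"
    using manifold_like_map_graph[OF dC e] N(2)
      by (intro manifold_like_imp_closed_manifold[OF IH]) auto
  moreover have del: "delete_points ?M {e None} = map_graph (e \<circ> Some) N"
    using delete_points_map_graph[OF dC e, of "{None}"] dN
    by (simp add: delete_None_cone_off map_graph_comp)
  have "isomorphism k (delete_points ?M {e None}) N"
    unfolding isomorphism_iff del
    using k dN by (auto simp: map_graph_comp inj_on_def map_graph_id)
  moreover have "nbrs ?M (e None) = e ` Some ` B"
    by (simp add: nbrs_map_graph[OF dC e] nbrs_cone_off)
  then have "k ` nbrs ?M (e None) = B"
    using k dN(2) by (force simp: image_image)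
  ultimately show ?thesis
    using manifold_with_boundary[of "Suc n" ?M "e None" k N] N(1) by simp
qed

section \<open>Rims in a closed-off space\<close>

lemma induced_cone_off:
  "digital_space N \<Longrightarrow> induced (cone_off N B) (Some ` S) = map_graph Some (induced N S)"
  by (rule graph_eqI) (auto simp: cone_off_def)

lemma nbrs_cone_off_Some:
  "nbrs (cone_off N B) (Some x) = Some ` nbrs N x \<union> (if x \<in> B then {None} else {})"
proof (rule set_eqI)
  fix y show "y \<in> nbrs (cone_off N B) (Some x) \<longleftrightarrow> y \<in> Some ` nbrs N x \<union> (if x \<in> B then {None} else {})"
    by (cases y) auto
qed

text \<open>The boundary is, up to renaming, the rim of the added point.\<close>

lemma disk_like_boundary_sphere_like:
  assumes "disk_like n D B" shows "sphere_like n (induced D B)"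
proof -
  have "sphere_like n (rim (cone_off D B) None)" using assms by (simp add: disk_like_def)
  then show ?thesis
    using disk_like_digital[OF assms] by (simp add: rim_def nbrs_cone_off induced_cone_off sphere_like_map_Some)
qed

text \<open>Off \<open>B\<close> the added point is not a neighbour, so closing off only renames the
  rim.\<close>

lemma disk_like_interior_sphere_like:
  assumes "disk_like n D B" "a \<in> points D - B" shows "sphere_like n (rim D a)"
proof -
  have "sphere_like n (rim (cone_off D B) (Some a))" using assms by (simp add: disk_like_def)
  then show ?thesis
    using disk_like_digital[OF assms(1)] assms(2)
    by (simp add: rim_def nbrs_cone_off_Some induced_cone_off sphere_like_map_Some)
qed

text \<open>From dimension 2 on, the two disks to be glued are the complement of a point
  \<open>v\<close> and the cone over its rim. The latter is a disk because closing it off gives a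
  suspension of the rim.\<close>

lemma sphere_like_imp_sphere: "sphere_like n (G :: 'a::infinite graph) \<Longrightarrow> sphere n G"
proof (induction n arbitrary: G)
  case 0
  then show ?case by (auto intro: sphere_0)
next
  case (Suc n)
  have dG: "digital_space G" using Suc.prems by simp
  note GG = digital_adjD[OF dG]
  show ?case
  proof (cases "n = 0")
    case True
    then show ?thesis
      using Suc finite_sphere_like[OF Suc.prems] sphere_1[of G] by (simp add: manifold_like_def)
  next
    case False
    obtain v where v: "v \<in> points G" "contractible (delete_points G {v})" using Suc.prems by auto
    let ?D = "delete_points G {v}" and ?B = "nbrs G v"
    have pmG: "manifold_like n G" using Suc.prems sphere_like_Suc_iff by blast
    have Bsub: "?B \<subseteq> points G" "v \<notin> ?B" using nbrs_subset[OF dG] dG by auto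
    have "isomorphism id ?D ?D"
      unfolding isomorphism_iff by (simp add: map_graph_id dG)
    then have "manifold_with_boundary (Suc n) ?D (id ` nbrs G v)"
      using manifold_like_imp_closed_manifold[OF Suc.IH pmG] v contractible_transformation_connected(1)
      by (intro manifold_with_boundary) auto
    then have D: "disk (Suc n) ?D ?B" using v(2) by (simp add: disk)
    \<comment> \<open>\<open>G\<close> is \<open>G - v\<close> glued to a copy of the cone over the rim of \<open>v\<close>, whose apex keeps the name \<open>v\<close>.\<close>
    let ?K = "induced G (insert v ?B)"
    have nvK: "nbrs ?K v = ?B" by auto
    have K: "disk_like n ?K ?B"
      unfolding disk_like_def
    \<comment> \<open>Closing off the cone adds a second apex: \<open>None\<close> joins
      \<open>Some v\<close> over the same rim.\<close>
    proof (rule sphere_like_suspension[where a = None and b = "Some v" and T = "Some ` ?B"])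
      show "digital_space (cone_off ?K ?B)"
        using dG Bsub by (auto simp: digital_cone_off_iff)
      show "points (cone_off ?K ?B) = insert None (insert (Some v) (Some ` ?B))"
        using Bsub v(1) by auto
      show "nbrs (cone_off ?K ?B) (Some v) = Some ` ?B"
        using Bsub(2) nvK by (simp add: nbrs_cone_off_Some del: nbrs_iff)
      have "?B \<inter> insert v ?B = ?B" "insert v ?B \<inter> ?B = ?B" by auto
      then show "sphere_like n (induced (cone_off ?K ?B) (Some ` ?B))"
        using Suc.prems v(1) dG by (simp add: induced_cone_off sphere_like_map_Some rim_def)
    qed (simp_all add: nbrs_cone_off)
    have finG: "finite (points G)" by (rule finite_sphere_like[OF Suc.prems])
    \<comment> \<open>The gluing rule wants disjoint disks, so the rim in the cone is moved to
      points outside the finite graph \<open>G\<close>.\<close>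
    obtain j :: "nat \<Rightarrow> 'a" where j: "inj j" "range j \<subseteq> UNIV - points G"
      using arb_countable_map[OF finG] by blast
    obtain c :: "'a \<Rightarrow> nat" where c: "inj_on c ?B"
      using finite_imp_inj_to_nat_seg[OF finite_subset[OF Bsub(1) finG]] by blast
    define e where "e = (\<lambda>x. if x = v then v else j (c x))"
    have eB: "e x \<notin> points G" "e x = j (c x)" if "x \<in> ?B" for x
      using that j(2) Bsub(2) by (auto simp: e_def)
    have ev: "e v = v" by (simp add: e_def)
    have ei: "inj_on e (insert v ?B)"
      using eB ev v(1) j(1) c by (auto simp: inj_on_def)
    have pK: "points ?K = insert v ?B" using Bsub v(1) by auto
    let ?C = "map_graph e ?K" and ?E = "e ` ?B"
    have C': "disk_like n ?C ?E" using ei pK by (intro disk_like_map_graph K) simp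
    then have C: "disk (Suc n) ?C ?E"
      using contractible_transformation_connected(1)
      by (auto simp: disk_like_iff intro!: disk manifold_like_imp_manifold_with_boundary Suc.IH)
    define f where "f = inv_into ?B e"
    have f: "f (e x) = x" if "x \<in> ?B" for x
      using that ei by (simp add: f_def inj_on_subset)
    have "isomorphism f (induced ?C ?E) (induced ?D ?B)"
    proof -
      have "?E \<subseteq> points ?C" using pK by auto
      have "induced ?C ?E = map_graph e (induced ?K ?B)"
        using ei pK dG by (subst map_graph_induced) auto
      also have "induced ?K ?B = rim G v"
      proof -
        have "insert v ?B \<inter> ?B = ?B" by auto
        then show ?thesis by (simp add: rim_def)
      qed
      finally have 1: "induced ?C ?E = map_graph e (rim G v)" .
      have 2: "induced ?D ?B = rim G v" using Bsub(2) GG(2,3) by (intro graph_eqI) (auto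
        simp: rim_def)
      have "map_graph f (map_graph e (rim G v)) = rim G v"
        unfolding map_graph_comp using f dG by (intro map_graph_id) auto
      moreover have "inj_on f (points (map_graph e (rim G v)))"
        using f by (auto simp: inj_on_def)
      ultimately show ?thesis unfolding 1 2 isomorphism_iff by simp
    qed
    moreover have "points ?D \<inter> points ?C = {}"
      using eB(1) ev pK by auto
    moreover have "isomorphism id (glue ?D ?C ?E f) G"
    proof -
      define g where "g = (\<lambda>x. if x \<in> ?E then f x else x)"
      have "v \<notin> ?E" using eB(1) v(1) by auto
      then have ge: "g (e x) = x" if "x \<in> points ?K" for x
        using that f ev unfolding pK g_def by auto
      have gC: "map_graph g ?C = ?K"
        unfolding map_graph_comp using ge dG by (intro map_graph_id) auto
      have "g ` points ?C = points ?K" using arg_cong[OF gC, of points] by simp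
      moreover have "map_prod g g ` adj ?C = adj ?K" using arg_cong[OF gC, of adj] by simp
      ultimately have "glue ?D ?C ?E f = \<lparr>points = points ?D \<union> points ?K, adj = adj ?D \<union> adj ?K\<rparr>"
        by (simp add: glue_def Let_def g_def)
      also have "\<dots> = G"
      proof (rule graph_eqI)
        show "adj \<lparr>points = points ?D \<union> points ?K, adj = adj ?D \<union> adj ?K\<rparr> = adj G"
          using GG(1-3) by (auto simp: pK)
      qed (use v(1) Bsub pK in auto)
      finally show ?thesis unfolding isomorphism_iff using dG by (simp add: map_graph_id)
    qed
    moreover have "Suc n \<ge> 2" using False by simp
    ultimately show ?thesis using sphere_n[OF _ D C] by blast
  qed
qed

lemma closed_manifold_iff: "closed_manifold (Suc n) M \<longleftrightarrow> manifold_like n M"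
  using sphere_imp_sphere_like(2) manifold_like_imp_closed_manifold sphere_like_imp_sphere by blast

lemma manifold_with_boundary_iff:
  "manifold_with_boundary (Suc n) N B \<longleftrightarrow> connected_graph N \<and> manifold_like n (cone_off N B)"
  using sphere_imp_sphere_like(3) manifold_like_imp_manifold_with_boundary sphere_like_imp_sphere
    by blast

section \<open>h-transformations\<close>

lemma manifold_like_rigid:
  assumes "manifold_like m N" "a \<in> points N" "S \<subseteq> nbrs N a" "sphere_like m (induced N S)"
  shows "S = nbrs N a"
proof -
  have d: "digital_space N" and h: "sphere_like m (rim N a)" using assms(1,2) by (auto
    simp: manifold_like_def)
  have "nbrs N a \<inter> S = S" using assms(3) by auto
  then have "sphere_like m (induced (rim N a) S)" using assms(4) by (simp add: rim_def)
  then show ?thesis using sphere_like_rigid[OF h, of S] assms(3) nbrs_subset[OF d, of a] by auto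
qed

text \<open>The sphere on \<open>S\<close> sits inside the rim of \<open>a\<close> in the closed-off
  manifold and hence fills it. If \<open>a\<close> were on the boundary, that rim would contain
  \<open>None\<close>, which \<open>S\<close> cannot reach.\<close>

lemma manifold_like_cone_off_rigid:
  assumes "manifold_like m (cone_off N B)" "a \<in> points N" "S \<subseteq> nbrs N a" "sphere_like m (induced N S)"
  shows "S = nbrs N a" "a \<notin> B"
proof -
  have "digital_space N" using assms(1) by (auto simp: manifold_like_def digital_cone_off_iff)
  then have "sphere_like m (induced (cone_off N B) (Some ` S))"
    using assms(4) by (simp add: induced_cone_off sphere_like_map_Some)
  moreover have "Some ` S \<subseteq> nbrs (cone_off N B) (Some a)"
    unfolding nbrs_cone_off_Some using assms(3) by blast
  ultimately have "Some ` S = nbrs (cone_off N B) (Some a)"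
    using assms(2) by (intro manifold_like_rigid[OF assms(1)]) auto
  then have *: "Some ` S = Some ` nbrs N a \<union> (if a \<in> B then {None} else {})"
    by (simp only: nbrs_cone_off_Some)
  show "a \<notin> B" using * by (auto split: if_splits)
  then show "S = nbrs N a" using * by auto
qed

text \<open>Rigidity enters as an assumption on \<open>N\<close>, so that closed manifolds and
  manifolds with boundary are treated alike. The last conclusion serves to show that the replaced
  points avoid the boundary of \<open>N\<close>.\<close>

lemma h_transformation_exchange:
  assumes N: "digital_space N"
      "\<forall>a \<in> points N. \<forall>S \<subseteq> nbrs N a. sphere_like m (induced N S) \<longrightarrow> S = nbrs N a"
    and h: "h_transformation (Suc m) N M"
  obtains W v A where "exchange (Suc m) W v A"
    "N = delete_points W {v} \<and> M = delete_points W A \<or> N = delete_points W A \<and> M = delete_points W {v}"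
    "\<And>x. x \<in> points N \<Longrightarrow> x \<in> insert v A \<Longrightarrow> sphere_like m (rim N x)"
  using h
proof cases
  case (replace_disk D B v)
  have D: "disk_like m D B" using sphere_imp_sphere_like(4)[OF replace_disk(2)] by auto
  have dD: "digital_space D" "B \<subseteq> points D" using disk_like_digital[OF D] by auto
  have DN: "points D \<subseteq> points N" "D = induced N (points D)"
    using replace_disk(3) by (auto simp: belongs_to_def)
  let ?W = "add_point N v B" and ?A = "points D - B"
  note NN = digital_adjD[OF N(1)]
  have dW: "digital_space ?W" using N(1) replace_disk(4) dD DN by (intro digital_add_point) auto
  have nv: "nbrs ?W v = B" using replace_disk(4) NN(2) DN dD(2) by auto
  \<comment> \<open>The rim of \<open>a\<close> in \<open>D\<close> is a sphere among the neighbours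
    of \<open>a\<close> in \<open>N\<close>, so by rigidity \<open>a\<close> has no neighbours
    outside \<open>D\<close>.\<close>
  have na: "nbrs N a = nbrs D a" "sphere_like m (rim N a)" if a: "a \<in> ?A" for a
  proof -
    have aD: "nbrs D a = nbrs N a \<inter> points D"
      using a by (subst DN(2)) auto
    have "sphere_like m (rim D a)" by (rule disk_like_interior_sphere_like[OF D a])
    moreover have "rim D a = induced N (nbrs D a)"
    proof -
      have "rim D a = induced (induced N (points D)) (nbrs D a)" using DN(2) by (simp add: rim_def)
      moreover have "points D \<inter> nbrs D a = nbrs D a" using nbrs_subset[OF dD(1)] by blast
      ultimately show ?thesis by simp
    qed
    ultimately have "sphere_like m (induced N (nbrs D a))" by simp
    moreover from this show "nbrs N a = nbrs D a" using N(2) a DN(1) aD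
      by (metis DiffD1 Int_lower1 subsetD)
    ultimately show "sphere_like m (rim N a)" by (simp add: rim_def)
  qed
  have DA: "?A \<union> B = points D" using dD(2) by auto
  have "induced ?W (insert v (points D)) = add_point D v B"
  proof (rule graph_eqI)
    have "adj D = adj N \<inter> points D \<times> points D" by (subst DN(2)) simp
    then show "adj (induced ?W (insert v (points D))) = adj (add_point D v B)"
      using NN(2,3) replace_disk(4) dD(2) by auto
  qed (use DN in auto)
  \<comment> \<open>This is the sphere \<open>cone_off D B\<close> with the added point named
    \<open>v\<close>.\<close>
  moreover have "sphere_like (Suc m) (add_point D v B)"
  proof -
    have vD: "v \<notin> points D" using DN(1) replace_disk(4) by auto
    have "map_graph (Some(v := None)) (add_point D v B) = cone_off D B"
      unfolding cone_off_def by (intro map_graph_add_point dD vD)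
    moreover have "digital_space (add_point D v B)" by (intro digital_add_point dD vD)
    moreover have "inj_on (Some(v := None)) (points (add_point D v B))"
      by (auto simp: inj_on_def)
    ultimately show ?thesis using D sphere_like_map_graph unfolding disk_like_def by metis
  qed
  ultimately have "sphere_like (Suc m) (induced ?W (insert v (?A \<union> nbrs ?W v)))"
    unfolding nv DA by simp
  moreover have "nbrs ?W a \<subseteq> ?A \<union> nbrs ?W v" if a: "a \<in> ?A" for a
  proof -
    have "nbrs ?W a = nbrs N a" using a DN(1) replace_disk(4) by auto
    then show ?thesis unfolding nv DA using na(1)[OF a] nbrs_subset[OF dD(1), of a] by simp
  qed
  ultimately have "exchange (Suc m) ?W v ?A"
    unfolding exchange_def using dW DN(1) replace_disk(4) by (auto
      simp: nv simp del: sphere_like.simps nbrs_iff)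
  moreover have "N = delete_points ?W {v}"
    using NN(2,3) replace_disk(4) by (intro graph_eqI) auto
  ultimately show ?thesis using that replace_disk(1,4) na(2) by blast
next
  case (replace_point v D B f)
  have D: "disk_like m D B" using sphere_imp_sphere_like(4)[OF replace_point(3)] by auto
  note g = glue_exchange[OF N(1) replace_point(2) D replace_point(4,5)]
  \<comment> \<open>The rim of \<open>v\<close> is a copy of the boundary of
    \<open>D\<close>.\<close>
  have "sphere_like m (rim N v)"
    using replace_point(5) disk_like_boundary_sphere_like[OF D] sphere_like_map_graph digital_sphere_like
    unfolding isomorphism_iff by metis
  then show ?thesis using that[OF g(1)] g(2) replace_point(1,4) by auto
qed

lemma delete_points_cone_off:
  "digital_space (cone_off W B) \<Longrightarrow> B \<inter> X = {} \<Longrightarrow>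
    delete_points (cone_off W B) (Some ` X) = cone_off (delete_points W X) B"
  by (drule cone_off_subset, rule graph_eqI) (auto simp: cone_off_def)

text \<open>Neither \<open>v\<close> nor a point of \<open>A\<close> acquires \<open>None\<close> as
  a neighbour, so the closed-up disk is only renamed.\<close>

lemma exchange_cone_off:
  assumes "exchange n W v A" "B \<subseteq> points W" "B \<inter> insert v A = {}"
  shows "exchange n (cone_off W B) (Some v) (Some ` A)"
proof -
  have e: "digital_space W" "v \<in> points W" "A \<subseteq> points W" "v \<notin> A" "A \<inter> nbrs W v = {}"
    "\<And>a. a \<in> A \<Longrightarrow> nbrs W a \<subseteq> A \<union> nbrs W v" "sphere_like n (induced W (insert v (A \<union> nbrs W v)))"
    using assms(1) by (auto simp: exchange_def)
  have n: "nbrs (cone_off W B) (Some x) = Some ` nbrs W x" if "x \<in> insert v A" for x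
    using assms(3) that by (auto simp: nbrs_cone_off_Some simp del: nbrs_iff)
  have "insert (Some v) (Some ` A \<union> Some ` nbrs W v) = Some ` insert v (A \<union> nbrs W v)" by auto
  then have "sphere_like n (induced (cone_off W B) (insert (Some v) (Some ` A \<union> Some ` nbrs W v)))"
    using e(1,7) by (simp only: induced_cone_off sphere_like_map_Some)
  moreover have "digital_space (cone_off W B)" using e(1) assms(2)
    by (simp add: digital_cone_off_iff)
  moreover have "Some ` A \<inter> Some ` nbrs W v = {}" using e(5) by auto
  moreover have "nbrs (cone_off W B) a \<subseteq> Some ` A \<union> Some ` nbrs W v" if a: "a \<in> Some ` A" for a
  proof -
    obtain x where x: "x \<in> A" "a = Some x" using a by blast
    then have "Some ` nbrs W x \<subseteq> Some ` (A \<union> nbrs W v)" by (intro image_mono e(6))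
    then show ?thesis using n[of x] x by (simp only: image_Un insertI2)
  qed
  ultimately show ?thesis
    unfolding exchange_def using e(2-4) n[of v] by (auto simp del: nbrs_iff)
qed

theorem lemma4p7:
  fixes n :: nat and N M :: "'a::infinite graph"
  assumes "n \<ge> 1"
    and "manifold n N"
    and "h_transformation n N M"
  shows "manifold n M"
proof -
  obtain m where n: "n = Suc m" using assms(1) by (cases n) auto
  from assms(2) consider "manifold_like m N" | B where "connected_graph N" "manifold_like m (cone_off N B)"
    unfolding manifold_def n closed_manifold_iff manifold_with_boundary_iff by blast
  then show ?thesis
  proof cases
    case 1
    have d: "digital_space N" using 1 by (simp add: manifold_like_def)
    obtain W v A where "exchange (Suc m) W v A"
      "N = delete_points W {v} \<and> M = delete_points W A \<or> N = delete_points W A \<and> M = delete_points W {v}"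
      using h_transformation_exchange[OF d _ assms(3)[unfolded n]] manifold_like_rigid[OF 1]
        by blast
    then have "manifold_like m M" using exchange_manifold_like 1 by metis
    then show ?thesis by (simp add: manifold_def n closed_manifold_iff)
  next
    case (2 B)
    have dc: "digital_space (cone_off N B)" using 2 by (simp add: manifold_like_def)
    then have d: "digital_space N" "B \<subseteq> points N" by (auto simp: digital_cone_off_iff)
    obtain W v A where ex: "exchange (Suc m) W v A"
      and NM: "N = delete_points W {v} \<and> M = delete_points W A \<or> N = delete_points W A \<and> M = delete_points W {v}"
      and rims: "\<And>x. x \<in> points N \<Longrightarrow> x \<in> insert v A \<Longrightarrow> sphere_like m (rim N x)"
      using h_transformation_exchange[OF d(1) _ assms(3)[unfolded n]] manifold_like_cone_off_rigid(1)[OF 2(2)] by blast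
    have BW: "B \<subseteq> points W" using NM d(2) by auto
    \<comment> \<open>A point of \<open>N\<close> with a full sphere as rim in \<open>N\<close> is
      off the boundary, so the transformation does not touch \<open>B\<close>, which can serve as
      the boundary of \<open>M\<close>.\<close>
    have Bi: "B \<inter> insert v A = {}"
      using rims d(2) manifold_like_cone_off_rigid(2)[OF 2(2), of _ "nbrs N _"] unfolding rim_def
        by blast
    have dW: "digital_space (cone_off W B)"
      using ex BW by (simp add: digital_cone_off_iff exchange_def)
    have "delete_points (cone_off W B) {Some v} = cone_off (delete_points W {v}) B"
      "delete_points (cone_off W B) (Some ` A) = cone_off (delete_points W A) B"
      using delete_points_cone_off[OF dW, of "{v}"] delete_points_cone_off[OF dW, of A] Bi by auto
    then have "manifold_like m (cone_off M B)"
      using exchange_manifold_like[OF exchange_cone_off[OF ex BW Bi]] NM 2(2) by metis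
    \<comment> \<open>Closing off may connect separate pieces, so connectedness of \<open>M\<close>
      has to be transferred on its own.\<close>
    moreover have "connected_graph M" using exchange_connected_iff[OF ex] NM 2(1) by metis
    ultimately show ?thesis by (auto simp: manifold_def n manifold_with_boundary_iff)
  qed
qed

end
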